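(* Let $k,r,m$ be positive integers with $k\ne r$ and let $\alpha>\max\{k,r\}$ be real. Then each of the sums $$\sum_{n=1}^\infty\frac{H_{n+\alpha}^{(m)}}{(n+r)(n+k)},\quad \sum_{n=1}^\infty\frac{H_{n+\alpha}H_{n+\alpha}^{(2)}}{(n+r)(n+k)},\quad \sum_{n=1}^\infty\frac{H_{n+\alpha}^3}{(n+r)(n+k)},\quad \sum_{n=1}^\infty\frac{H_{n+\alpha}^2H_{n+\alpha}^{(2)}}{(n+r)(n+k)}$$ is equal to a finite sum of terms of the form $c(\alpha)\prod_{i}\zeta(s_i)\prod_{j}H^{(m_j)}_{\alpha+t_j}$, where $c$ is a rational function of $\alpha$ with rational coefficients (depending on $k,r,m$), the $s_i\ge2$ and $m_j\ge1$ are integers, and the $t_j$ are integers.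
   Context: Shifted harmonic numbers: for a real $\alpha$ that is not a negative integer, $H_\alpha := \sum_{k=1}^\infty\left(\frac1k-\frac1{k+\alpha}\right)$ and, for integers $m\ge 2$, $H_\alpha^{(m)} := \sum_{k=1}^\infty\left(\frac1{k^m}-\frac1{(k+\alpha)^m}\right)=\zeta(m)-\zeta(m,\alpha+1)$, where $\zeta$ is the Riemann zeta function and $\zeta(s,\alpha+1)=\sum_{n=1}^\infty (n+\alpha)^{-s}$ is the Hurwitz zeta function; $H_\alpha^{(1)}:=H_\alpha$. Powers such as $H_\alpha^2$ mean $(H_\alpha)^2$. *)

theory Defs
  imports "HOL-Analysis.Analysis" "HOL-Computational_Algebra.Polynomial"
begin

definition shifted_harm :: "nat \<Rightarrow> real \<Rightarrow> real" where
  "shifted_harm m a = (\<Sum>k. 1 / (real (Suc k)) ^ m - 1 / (real (Suc k) + a) ^ m)"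

definition zeta_nat :: "nat \<Rightarrow> real" where
  "zeta_nat s = (\<Sum>n. 1 / (real (Suc n)) ^ s)"

definition rat_fun :: "rat poly \<Rightarrow> rat poly \<Rightarrow> real \<Rightarrow> real" where
  "rat_fun p q x = poly (map_poly of_rat p) x / poly (map_poly of_rat q) x"

text \<open>A term  c(a) * prod_i zeta(s_i) * prod_j H^(m_j)_(a+t_j)  is encoded as
  (numerator of c, denominator of c, list of s_i, list of pairs (m_j, t_j)).\<close>
type_synonym zh_term = "rat poly \<times> rat poly \<times> nat list \<times> (nat \<times> int) list"

definition zh_term_val :: "zh_term \<Rightarrow> real \<Rightarrow> real" where
  "zh_term_val tm a = (case tm of (p, q, ss, hs) \<Rightarrow>
      rat_fun p q a * prod_list (map zeta_nat ss)
        * prod_list (map (\<lambda>(m, t). shifted_harm m (a + of_int t)) hs))"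

definition zh_term_shape :: "zh_term \<Rightarrow> bool" where
  "zh_term_shape tm = (case tm of (p, q, ss, hs) \<Rightarrow>
      (\<forall>s\<in>set ss. s \<ge> 2) \<and> (\<forall>(m, t)\<in>set hs. m \<ge> 1))"

definition zh_term_defined :: "zh_term \<Rightarrow> real \<Rightarrow> bool" where
  "zh_term_defined tm a = (case tm of (p, q, ss, hs) \<Rightarrow>
      poly (map_poly of_rat q) a \<noteq> 0 \<and>
      (\<forall>(m, t)\<in>set hs. \<not> (\<exists>j::nat. j \<ge> 1 \<and> a + of_int t = - of_nat j)))"

definition has_zeta_harm_form :: "nat \<Rightarrow> nat \<Rightarrow> (real \<Rightarrow> nat \<Rightarrow> real) \<Rightarrow> bool" where
  "has_zeta_harm_form k r f =
     (\<exists>ts :: zh_term list. (\<forall>tm\<in>set ts. zh_term_shape tm) \<and>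
        (\<forall>a::real. a > real (max k r) \<longrightarrow>
           (\<forall>tm\<in>set ts. zh_term_defined tm a) \<and>
           (\<lambda>n. f a (Suc n)) sums (\<Sum>tm\<leftarrow>ts. zh_term_val tm a)))"

end

theory Submission
  imports Defs
begin

text \<open>
  Let \<open>h\<^sub>j(x)\<close> and \<open>e\<^sub>j(x)\<close> be the complete and the elementary symmetric functions whose power sums
  are \<open>p\<^sub>i = H\<^sub>x\<^sup>(\<^sup>i\<^sup>)\<close>. They satisfy \<open>h\<^sub>j(x) - h\<^sub>j(x-1) = h\<^sub>j\<^sub>-\<^sub>1(x) / x\<close> and
  \<open>e\<^sub>j(x) - e\<^sub>j(x-1) = e\<^sub>j\<^sub>-\<^sub>1(x-1) / x\<close>, and for \<open>d > 0\<close>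
  \<open>\<Sum>\<^sub>n\<^sub>\<ge>\<^sub>1 h\<^sub>j(n+d) (1/n - 1/(n+d)) = (j+1) h\<^sub>j\<^sub>+\<^sub>1(d)\<close>,
  \<open>\<Sum>\<^sub>n\<^sub>\<ge>\<^sub>1 e\<^sub>j(n+d-1) (1/n - 1/(n+d)) = \<Sum>\<^sub>i\<^sub>\<le>\<^sub>j T\<^sub>i(d) e\<^sub>j\<^sub>-\<^sub>i(d)\<close>,
  where \<open>T\<^sub>0(d) = H\<^sub>d\<close> and \<open>T\<^sub>i\<^sub>+\<^sub>1(d) = \<zeta>(i+2) - T\<^sub>i(d) / d\<close>.
  Each identity holds because, by induction on \<open>j\<close>, the difference of its two sides is 1-periodic in
  \<open>d\<close>; it also varies slowly at infinity, hence is constant, and it is \<open>O(d)\<close> at 0, hence vanishes.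

  Since \<open>r\<close> and \<open>k\<close> are integers, reindexing turns the series of \<open>h\<^sub>j(n+\<alpha>)\<close> and \<open>e\<^sub>j(n+\<alpha>)\<close> over
  \<open>(n+r)(n+k)\<close> into these sums up to finitely many terms. The remaining ingredient,
  \<open>H\<^sup>(\<^sup>m\<^sup>)\<close> alone, is handled by telescoping and partial fractions, and
  \<open>H H\<^sup>(\<^sup>2\<^sup>) = h\<^sub>3 - e\<^sub>3\<close>, \<open>H\<^sup>3 = 3h\<^sub>3 + 3e\<^sub>3 - 2H\<^sup>(\<^sup>3\<^sup>)\<close>,
  \<open>H\<^sup>2 H\<^sup>(\<^sup>2\<^sup>) = 2h\<^sub>4 - 2e\<^sub>4 - H\<^sup>(\<^sup>4\<^sup>)\<close>.
\<close>

section \<open>Shifted harmonic numbers and their symmetric functions\<close>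

lemma summable_Suc_powr: "e > 1 \<Longrightarrow> summable (\<lambda>n. real (Suc n) powr (-e))"
  using summable_real_powr_iff[of "-e"] summable_Suc_iff[of "\<lambda>n. real n powr (-e)"] by simp

lemma summable_inverse_Suc_power:
  assumes "m \<ge> 2" shows "summable (\<lambda>n. 1 / real (Suc n) ^ m)"
  using inverse_power_summable[OF assms, where 'a=real]
    summable_Suc_iff[of "\<lambda>n. inverse (real n ^ m)"]
  by (simp add: inverse_eq_divide)

text \<open>With \<open>u = K / (K + x)\<close> the term is \<open>(1 - u ^ m) / K ^ m\<close>.
  Bernoulli bounds \<open>1 - u ^ m\<close> by \<open>m * (1 - u)\<close>, and
  \<open>1 - u = x / (K + x)\<close> lies in [0,1], so the power \<open>e\<close> only enlarges it.
  The exponent trades growth in \<open>x\<close> for decay in \<open>k\<close>: \<open>e = 1\<close>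
  yields linearity at 0, small \<open>e\<close> yields slow growth.\<close>

lemma harm_term_bounds:
  fixes x e :: real
  assumes "x \<ge> 0" "0 < e" "e \<le> 1"
  shows "0 \<le> 1 / real (Suc k) ^ m - 1 / (real (Suc k) + x) ^ m"
    and "1 / real (Suc k) ^ m - 1 / (real (Suc k) + x) ^ m \<le> m * (x powr e * real (Suc k) powr (-(1+e)))"
proof -
  define K where "K = real (Suc k)"
  have K: "K \<ge> 1" by (simp add: K_def)
  define u where "u = K / (K + x)"
  have u: "0 < u" "u \<le> 1" using K assms by (auto simp: u_def field_simps)
  have eq: "1 / K ^ m - 1 / (K + x) ^ m = (1 - u ^ m) / K ^ m"
    using K assms by (simp add: u_def power_divide field_simps)
  have um: "u ^ m \<le> 1" using u by (simp add: power_le_one)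
  show "0 \<le> 1 / real (Suc k) ^ m - 1 / (real (Suc k) + x) ^ m"
    unfolding K_def[symmetric] eq using um K by simp
  show "1 / real (Suc k) ^ m - 1 / (real (Suc k) + x) ^ m \<le> m * (x powr e * real (Suc k) powr (-(1+e)))"
  proof (cases "m = 0")
    case False
    have "1 + m * (u - 1) \<le> (1 + (u - 1)) ^ m"
      by (rule Bernoulli_inequality) (use u in auto)
    hence "1 - u ^ m \<le> m * (1 - u)" by (simp add: algebra_simps)
    also have "1 - u \<le> (x / K) powr e"
    proof -
      have 1: "1 - u = x / (K + x)" using K assms by (simp add: u_def field_simps)
      have "x / (K + x) \<le> (x / (K + x)) powr e"
      proof (cases "x = 0")
        case False
        have "(x / (K + x)) powr 1 \<le> (x / (K + x)) powr e"
          using False assms K by (intro powr_mono') (auto simp: field_simps)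
        thus ?thesis using False assms K by simp
      qed simp
      also have "\<dots> \<le> (x / K) powr e"
        using assms K by (intro powr_mono2) (auto simp: frac_le)
      finally show ?thesis using 1 by simp
    qed
    finally have 2: "1 - u ^ m \<le> m * (x / K) powr e" by (simp add: mult_left_mono)
    have "(1 - u ^ m) / K ^ m \<le> (1 - u ^ m) / K"
      using um K False by (intro divide_left_mono) (auto intro!: self_le_power)
    also have "\<dots> \<le> m * (x / K) powr e / K" using 2 K by (intro divide_right_mono) auto
    also have "(x / K) powr e / K = x powr e * K powr (-(1+e))"
      using K assms by (simp only: minus_add_distrib powr_add powr_divide) (simp add: powr_minus divide_simps)
    hence "m * (x / K) powr e / K = m * (x powr e * K powr (-(1+e)))"
      by (metis times_divide_eq_right)
    finally show ?thesis unfolding K_def[symmetric] eq .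
  qed simp
qed

lemma summable_shifted_harm:
  assumes "x \<ge> 0"
  shows "summable (\<lambda>k. 1 / real (Suc k) ^ m - 1 / (real (Suc k) + x) ^ m)"
proof (rule summable_comparison_test)
  show "summable (\<lambda>k. m * (x powr 1 * real (Suc k) powr (-(1+1))))"
    by (intro summable_mult summable_Suc_powr) simp
  show "\<exists>N. \<forall>k\<ge>N. norm (1 / real (Suc k) ^ m - 1 / (real (Suc k) + x) ^ m)
      \<le> m * (x powr 1 * real (Suc k) powr (-(1+1)))"
    using harm_term_bounds[OF assms, of 1] by (intro exI[of _ 0]) (auto simp: abs_of_nonneg)
qed

lemma shifted_harm_sums:
  "x \<ge> 0 \<Longrightarrow> (\<lambda>k. 1 / real (Suc k) ^ m - 1 / (real (Suc k) + x) ^ m) sums shifted_harm m x"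
  unfolding shifted_harm_def by (intro summable_sums summable_shifted_harm)

lemma shifted_harm_0: "shifted_harm m 0 = 0"
  by (simp add: shifted_harm_def)

lemma shifted_harm_mono:
  assumes "0 \<le> x" "x \<le> y" shows "shifted_harm m x \<le> shifted_harm m y"
proof -
  have "1 / (real (Suc k) + y) ^ m \<le> 1 / (real (Suc k) + x) ^ m" for k
    using assms by (intro divide_left_mono power_mono) auto
  thus ?thesis using assms unfolding shifted_harm_def
    by (intro suminf_le summable_shifted_harm) (auto intro: diff_left_mono)
qed

lemma shifted_harm_nonneg: "x \<ge> 0 \<Longrightarrow> shifted_harm m x \<ge> 0"
  using shifted_harm_mono[of 0 x m] by (simp add: shifted_harm_0)

text \<open>The two series differ termwise by \<open>g n - g (Suc n)\<close>, which telescopes; that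
  \<open>g\<close> tends to 0 is where \<open>m > 0\<close> enters.\<close>

lemma shifted_harm_plus1:
  assumes "x \<ge> 0" "m > 0"
  shows "shifted_harm m (x + 1) = shifted_harm m x + 1 / (x + 1) ^ m"
proof -
  define g where "g n = 1 / (real (Suc n) + x) ^ m" for n
  have "filterlim (\<lambda>n. x + real (Suc n)) at_top sequentially"
    by (intro filterlim_tendsto_add_at_top[OF tendsto_const]
        filterlim_compose[OF filterlim_real_sequentially filterlim_Suc])
  hence "(\<lambda>n. 1 / (real (Suc n) + x)) \<longlonglongrightarrow> 0"
    by (intro tendsto_divide_0[OF tendsto_const] filterlim_at_top_imp_at_infinity) (simp add: add.commute)
  hence "(\<lambda>n. (1 / (real (Suc n) + x)) ^ m) \<longlonglongrightarrow> 0 ^ m" by (rule tendsto_power)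
  hence "g \<longlonglongrightarrow> 0" using assms unfolding g_def by (simp add: power_divide zero_power del: of_nat_Suc)
  from telescope_sums'[OF this] have "(\<lambda>n. g n - g (Suc n)) sums (1 / (x + 1) ^ m)"
    by (simp add: g_def add.commute)
  from sums_add[OF shifted_harm_sums[OF assms(1), of m] this]
  have "(\<lambda>k. 1 / real (Suc k) ^ m - 1 / (real (Suc k) + (x + 1)) ^ m) sums (shifted_harm m x + 1 / (x + 1) ^ m)"
    by (simp add: g_def add_ac)
  thus ?thesis using shifted_harm_sums[of "x+1" m] assms sums_unique2 by auto
qed

text \<open>Summing the term bound over \<open>k\<close> gives the constant m * zeta(1 + e).\<close>

lemma shifted_harm_le_powr:
  assumes "0 < e" "e \<le> 1"
  obtains C where "C \<ge> 0" "\<And>x. x \<ge> 0 \<Longrightarrow> shifted_harm m x \<le> C * x powr e"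
proof
  define Z where "Z = (\<Sum>k. real (Suc k) powr (-(1+e)))"
  have s: "summable (\<lambda>k. real (Suc k) powr (-(1+e)))" using assms by (intro summable_Suc_powr) simp
  show "m * Z \<ge> 0" unfolding Z_def by (intro mult_nonneg_nonneg suminf_nonneg s) auto
  show "shifted_harm m x \<le> m * Z * x powr e" if "x \<ge> 0" for x
  proof -
    have "shifted_harm m x \<le> (\<Sum>k. m * x powr e * real (Suc k) powr (-(1+e)))"
      unfolding shifted_harm_def using that assms harm_term_bounds(2)[OF that assms, of _ m]
      by (intro suminf_le summable_shifted_harm summable_mult s) (auto simp: mult_ac)
    also have "\<dots> = m * x powr e * Z" unfolding Z_def by (intro suminf_mult s)
    finally show ?thesis by (simp add: mult_ac)
  qed
qed

text \<open>Newton's identities: the complete homogeneous symmetric function with power sums \<^term>\<open>p\<close>.\<close>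
fun hsym :: "(nat \<Rightarrow> real) \<Rightarrow> nat \<Rightarrow> real" where
  "hsym p 0 = 1"
| "hsym p (Suc j) = (\<Sum>i\<le>j. p (Suc i) * hsym p (j - i)) / real (Suc j)"

declare hsym.simps(2) [simp del]

text \<open>Adjoining a variable \<open>q\<close> adds \<open>q ^ i\<close> to the power sums and
  multiplies the generating function of the complete symmetric functions by 1/(1 - q t); the claim
  compares the coefficients of t^(j+1). The proof works with Newton's recursion alone.\<close>

lemma hsym_add_power:
  assumes "\<And>i. i > 0 \<Longrightarrow> p' i = p i + q ^ i"
  shows "hsym p' (Suc j) = hsym p (Suc j) + q * hsym p' j"
proof (induction j rule: less_induct)
  case (less j)
  let ?H = "hsym p'" and ?G = "hsym p"
  \<comment> \<open>Iterating the induction hypothesis, available below \<open>j\<close>, expands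
    \<open>?H l\<close> in powers of \<open>q\<close>.\<close>
  have tel: "(\<Sum>i\<le>l. q ^ i * ?G (l - i)) = ?H l" if "l \<le> j" for l
    using that
  proof (induction l)
    case (Suc l)
    have "(\<Sum>i\<le>Suc l. q ^ i * ?G (Suc l - i)) = ?G (Suc l) + q * (\<Sum>i\<le>l. q ^ i * ?G (l - i))"
      by (subst sum.atMost_Suc_shift) (simp add: sum_distrib_left mult_ac)
    also have "\<dots> = ?H (Suc l)" using Suc less.IH[of l] by simp
    finally show ?case .
  qed simp
  \<comment> \<open>For \<open>i < j\<close> the induction hypothesis splits
    \<open>?H (j - i)\<close>; the parts carrying \<open>q\<close> form Newton's sum for
    \<open>j * ?H j\<close>. The term \<open>i = j\<close> is unchanged because both functions are 1
    at index 0.\<close>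
  have "(\<Sum>i\<le>j. p' (Suc i) * ?H (j - i)) = (\<Sum>i\<le>j. p' (Suc i) * ?G (j - i)) + q * (real j * ?H j)"
  proof (cases j)
    case (Suc l)
    have "(\<Sum>i\<le>l. p' (Suc i) * ?H (Suc l - i)) =
        (\<Sum>i\<le>l. p' (Suc i) * ?G (Suc l - i) + q * (p' (Suc i) * ?H (l - i)))"
      using less.IH Suc by (intro sum.cong) (auto simp: Suc_diff_le algebra_simps)
    also have "\<dots> = (\<Sum>i\<le>l. p' (Suc i) * ?G (Suc l - i)) + q * (real (Suc l) * ?H (Suc l))"
      by (simp add: sum.distrib hsym.simps(2) del: of_nat_Suc flip: sum_distrib_left)
    finally show ?thesis using Suc by simp
  qed simp
  also have "(\<Sum>i\<le>j. p' (Suc i) * ?G (j - i)) =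
      (\<Sum>i\<le>j. p (Suc i) * ?G (j - i)) + q * (\<Sum>i\<le>j. q ^ i * ?G (j - i))"
    by (simp add: assms sum.distrib sum_distrib_left algebra_simps)
  finally have "real (Suc j) * ?H (Suc j) = real (Suc j) * ?G (Suc j) + q * ?H j + q * (real j * ?H j)"
    using tel[of j] by (simp add: hsym.simps(2))
  hence "real (Suc j) * ?H (Suc j) = real (Suc j) * (?G (Suc j) + q * ?H j)"
    by (simp add: algebra_simps)
  thus ?case by (simp del: of_nat_Suc)
qed

definition complete_harm :: "nat \<Rightarrow> real \<Rightarrow> real" where
  "complete_harm j x = hsym (\<lambda>i. shifted_harm i x) j"

text \<open>Replacing \<open>p\<^sub>i\<close> by \<open>(-1)\<^sup>i\<^sup>-\<^sup>1 p\<^sub>i\<close> turns complete into elementary symmetric functions.\<close>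
definition elem_harm :: "nat \<Rightarrow> real \<Rightarrow> real" where
  "elem_harm j x = hsym (\<lambda>i. - ((-1) ^ i) * shifted_harm i x) j"

text \<open>Passing from \<open>x\<close> to \<open>x + 1\<close> adjoins the variable
  \<open>1 / (x + 1)\<close>.\<close>

lemma complete_harm_plus1: "x \<ge> 0 \<Longrightarrow> complete_harm (Suc j) (x + 1) = complete_harm (Suc j) x + complete_harm j (x + 1) / (x + 1)"
  unfolding complete_harm_def
  by (subst hsym_add_power[where p = "\<lambda>i. shifted_harm i x" and q = "1 / (x + 1)"])
     (auto simp: shifted_harm_plus1 power_divide)

text \<open>With the alternating signs, passing down from \<open>x + 1\<close> to \<open>x\<close>
  adjoins the variable \<open>- 1 / (x + 1)\<close>; hence the lower function is taken at
  \<open>x\<close>, not at \<open>x + 1\<close>.\<close>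

lemma elem_harm_plus1: "x \<ge> 0 \<Longrightarrow> elem_harm (Suc j) (x + 1) = elem_harm (Suc j) x + elem_harm j x / (x + 1)"
  unfolding elem_harm_def
  by (subst hsym_add_power[where p = "\<lambda>i. - ((-1) ^ i) * shifted_harm i (x + 1)"
       and p' = "\<lambda>i. - ((-1) ^ i) * shifted_harm i x" and q = "(- 1) / (x + 1)"])
     (simp_all add: shifted_harm_plus1 power_divide[of "- 1"] distrib_left del: divide_minus_left)

text \<open>Elementary functions arise from complete ones by negating the even power sums, so sums
  and differences of the two keep only the monomials of one parity. In these weights just the wanted
  product and one pure power sum survive.\<close>

lemma newton_products:
  "shifted_harm 1 x * shifted_harm 2 x = complete_harm 3 x - elem_harm 3 x"
  "shifted_harm 1 x ^ 3 = 3 * complete_harm 3 x + 3 * elem_harm 3 x - 2 * shifted_harm 3 x"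
  "shifted_harm 1 x ^ 2 * shifted_harm 2 x = 2 * complete_harm 4 x - 2 * elem_harm 4 x - shifted_harm 4 x"
  by (simp_all add: complete_harm_def elem_harm_def hsym.simps(2) eval_nat_numeral field_simps)

section \<open>Slowly varying functions\<close>

text \<open>
  Unlike logarithmic bounds, a bound for every exponent \<open>e\<close> is stable under products without
  tracking degrees.
\<close>
definition tame :: "(real \<Rightarrow> real) \<Rightarrow> bool" where
  "tame f \<longleftrightarrow> (\<forall>e. 0 < e \<and> e < 1 \<longrightarrow> (\<exists>C. \<forall>x y. 0 \<le> x \<and> x \<le> y \<and> y \<le> x + 1 \<longrightarrow>
     \<bar>f x\<bar> \<le> C * (1 + x) powr e \<and> \<bar>f y - f x\<bar> \<le> C * (1 + x) powr (e - 1)))"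

lemma tameE:
  assumes "tame f" "0 < e" "e < 1"
  obtains C where "C \<ge> 0" "\<And>x. 0 \<le> x \<Longrightarrow> \<bar>f x\<bar> \<le> C * (1 + x) powr e"
    "\<And>x y. 0 \<le> x \<Longrightarrow> x \<le> y \<Longrightarrow> y \<le> x + 1 \<Longrightarrow> \<bar>f y - f x\<bar> \<le> C * (1 + x) powr (e - 1)"
proof -
  from assms obtain C where C: "\<forall>x y. 0 \<le> x \<and> x \<le> y \<and> y \<le> x + 1 \<longrightarrow>
     \<bar>f x\<bar> \<le> C * (1 + x) powr e \<and> \<bar>f y - f x\<bar> \<le> C * (1 + x) powr (e - 1)"
    unfolding tame_def by blast
  have "\<bar>f 0\<bar> \<le> C" using C[rule_format, of 0 0] by simp
  hence "C \<ge> 0" by simp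
  show ?thesis
  proof (rule that[OF \<open>C \<ge> 0\<close>])
    show "\<bar>f x\<bar> \<le> C * (1 + x) powr e" if "0 \<le> x" for x
      using C[rule_format, of x x] that by simp
    show "\<bar>f y - f x\<bar> \<le> C * (1 + x) powr (e - 1)" if "0 \<le> x" "x \<le> y" "y \<le> x + 1" for x y
      using C that by blast
  qed
qed

lemma tameI:
  assumes "\<And>e. 0 < e \<Longrightarrow> e < 1 \<Longrightarrow> \<exists>C. \<forall>x y. 0 \<le> x \<and> x \<le> y \<and> y \<le> x + 1 \<longrightarrow>
     \<bar>f x\<bar> \<le> C * (1 + x) powr e \<and> \<bar>f y - f x\<bar> \<le> C * (1 + x) powr (e - 1)"
  shows "tame f"
  using assms unfolding tame_def by blast

lemma tame_const: "tame (\<lambda>_. c)"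
proof (rule tameI)
  fix e :: real assume e: "0 < e" "e < 1"
  have "1 \<le> (1 + x) powr e" if "x \<ge> 0" for x using that e by (intro ge_one_powr_ge_zero) auto
  hence "\<bar>c\<bar> \<le> \<bar>c\<bar> * (1 + x) powr e" if "x \<ge> 0" for x using that
    by (metis mult.right_neutral mult_left_mono abs_ge_zero)
  thus "\<exists>C. \<forall>x y. 0 \<le> x \<and> x \<le> y \<and> y \<le> x + 1 \<longrightarrow>
     \<bar>c\<bar> \<le> C * (1 + x) powr e \<and> \<bar>c - c\<bar> \<le> C * (1 + x) powr (e - 1)"
    by (intro exI[of _ "\<bar>c\<bar>"]) auto
qed

lemma tame_add:
  assumes "tame f" "tame g" shows "tame (\<lambda>x. f x + g x)"
proof (rule tameI)
  fix e :: real assume e: "0 < e" "e < 1"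
  obtain C where C: "C \<ge> 0" "\<And>x. 0 \<le> x \<Longrightarrow> \<bar>f x\<bar> \<le> C * (1 + x) powr e"
    "\<And>x y. 0 \<le> x \<Longrightarrow> x \<le> y \<Longrightarrow> y \<le> x + 1 \<Longrightarrow> \<bar>f y - f x\<bar> \<le> C * (1 + x) powr (e - 1)"
    using tameE[OF assms(1) e] by blast
  obtain B where B: "B \<ge> 0" "\<And>x. 0 \<le> x \<Longrightarrow> \<bar>g x\<bar> \<le> B * (1 + x) powr e"
    "\<And>x y. 0 \<le> x \<Longrightarrow> x \<le> y \<Longrightarrow> y \<le> x + 1 \<Longrightarrow> \<bar>g y - g x\<bar> \<le> B * (1 + x) powr (e - 1)"
    using tameE[OF assms(2) e] by blast
  show "\<exists>C. \<forall>x y. 0 \<le> x \<and> x \<le> y \<and> y \<le> x + 1 \<longrightarrow>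
     \<bar>f x + g x\<bar> \<le> C * (1 + x) powr e \<and> \<bar>f y + g y - (f x + g x)\<bar> \<le> C * (1 + x) powr (e - 1)"
  proof (intro exI[of _ "C + B"] allI impI)
    fix x y :: real assume xy: "0 \<le> x \<and> x \<le> y \<and> y \<le> x + 1"
    show "\<bar>f x + g x\<bar> \<le> (C + B) * (1 + x) powr e \<and> \<bar>f y + g y - (f x + g x)\<bar> \<le> (C + B) * (1 + x) powr (e - 1)"
      unfolding distrib_right
      using C(2)[of x] C(3)[of x y] B(2)[of x] B(3)[of x y] xy by linarith
  qed
qed

text \<open>Both factors are used with exponent \<open>e/2\<close>, and the increment is split by
  the discrete product rule.\<close>

lemma tame_mult:
  assumes "tame f" "tame g" shows "tame (\<lambda>x. f x * g x)"
proof (rule tameI)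
  fix e :: real assume e: "0 < e" "e < 1"
  obtain C where C: "C \<ge> 0" "\<And>x. 0 \<le> x \<Longrightarrow> \<bar>f x\<bar> \<le> C * (1 + x) powr (e/2)"
    "\<And>x y. 0 \<le> x \<Longrightarrow> x \<le> y \<Longrightarrow> y \<le> x + 1 \<Longrightarrow> \<bar>f y - f x\<bar> \<le> C * (1 + x) powr (e/2 - 1)"
    using tameE[OF assms(1), of "e/2"] e by auto
  obtain B where B: "B \<ge> 0" "\<And>x. 0 \<le> x \<Longrightarrow> \<bar>g x\<bar> \<le> B * (1 + x) powr (e/2)"
    "\<And>x y. 0 \<le> x \<Longrightarrow> x \<le> y \<Longrightarrow> y \<le> x + 1 \<Longrightarrow> \<bar>g y - g x\<bar> \<le> B * (1 + x) powr (e/2 - 1)"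
    using tameE[OF assms(2), of "e/2"] e by auto
  show "\<exists>C. \<forall>x y. 0 \<le> x \<and> x \<le> y \<and> y \<le> x + 1 \<longrightarrow>
     \<bar>f x * g x\<bar> \<le> C * (1 + x) powr e \<and> \<bar>f y * g y - (f x * g x)\<bar> \<le> C * (1 + x) powr (e - 1)"
  proof (intro exI[of _ "3 * (C * B)"] allI impI conjI)
    fix x y :: real assume xy: "0 \<le> x \<and> x \<le> y \<and> y \<le> x + 1"
    define P where "P = (1 + x) powr (e/2)"
    define Q where "Q = (1 + x) powr (e/2 - 1)"
    have PQ: "P \<ge> 0" "Q \<ge> 0" "Q \<le> P" using xy by (auto simp: P_def Q_def intro!: powr_mono)
    have PP: "(1 + x) powr e = P * P" "(1 + x) powr (e - 1) = P * Q"
      by (simp_all add: P_def Q_def powr_add[symmetric])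
    have f: "\<bar>f x\<bar> \<le> C * P" "\<bar>f y - f x\<bar> \<le> C * Q" and g: "\<bar>g x\<bar> \<le> B * P" "\<bar>g y - g x\<bar> \<le> B * Q"
      using C(2)[of x] C(3)[of x y] B(2)[of x] B(3)[of x y] xy by (auto simp: P_def Q_def)
    have "\<bar>f x\<bar> * \<bar>g x\<bar> \<le> (C * P) * (B * P)" using f g C B PQ by (intro mult_mono) auto
    also have "\<dots> \<le> 3 * (C * B) * (P * P)" using C B PQ by (simp add: mult_ac)
    finally show "\<bar>f x * g x\<bar> \<le> 3 * (C * B) * (1 + x) powr e" by (simp add: PP abs_mult)
    have "B * Q \<le> B * P" using B PQ by (intro mult_left_mono) auto
    \<comment> \<open>The value at \<open>y\<close> is the value at \<open>x\<close> plus an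
      increment, and \<open>Q \<le> P\<close>; this factor 2 accounts for the constant 3.\<close>
    hence gy: "\<bar>g y\<bar> \<le> 2 * B * P" using g by linarith
    have "f y * g y - f x * g x = (f y - f x) * g y + f x * (g y - g x)" by (simp add: algebra_simps)
    also have "\<bar>\<dots>\<bar> \<le> \<bar>f y - f x\<bar> * \<bar>g y\<bar> + \<bar>f x\<bar> * \<bar>g y - g x\<bar>"
      by (metis abs_mult abs_triangle_ineq)
    also have "\<dots> \<le> (C * Q) * (2 * B * P) + (C * P) * (B * Q)"
      using f g gy C B PQ by (intro add_mono mult_mono) auto
    finally show "\<bar>f y * g y - (f x * g x)\<bar> \<le> 3 * (C * B) * (1 + x) powr (e - 1)"
      by (simp add: PP mult_ac)
  qed
qed

lemma tame_cmult: "tame f \<Longrightarrow> tame (\<lambda>x. c * f x)"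
  using tame_mult[OF tame_const] .

lemma tame_sum: "(\<And>i. i \<in> A \<Longrightarrow> tame (f i)) \<Longrightarrow> tame (\<lambda>x. \<Sum>i\<in>A. f i x)"
  by (induction A rule: infinite_finite_induct) (auto intro: tame_const tame_add)

lemma tame_dominated:
  assumes "tame g" "\<And>x. 0 \<le> x \<Longrightarrow> \<bar>f x\<bar> \<le> \<bar>g x\<bar>"
    "\<And>x y. 0 \<le> x \<Longrightarrow> x \<le> y \<Longrightarrow> \<bar>f y - f x\<bar> \<le> \<bar>g y - g x\<bar>"
  shows "tame f"
proof (rule tameI)
  fix e :: real assume "0 < e" "e < 1"
  then obtain C where C: "C \<ge> 0" "\<And>x. 0 \<le> x \<Longrightarrow> \<bar>g x\<bar> \<le> C * (1 + x) powr e"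
    "\<And>x y. 0 \<le> x \<Longrightarrow> x \<le> y \<Longrightarrow> y \<le> x + 1 \<Longrightarrow> \<bar>g y - g x\<bar> \<le> C * (1 + x) powr (e - 1)"
    using tameE[OF assms(1)] by blast
  show "\<exists>C. \<forall>x y. 0 \<le> x \<and> x \<le> y \<and> y \<le> x + 1 \<longrightarrow>
     \<bar>f x\<bar> \<le> C * (1 + x) powr e \<and> \<bar>f y - f x\<bar> \<le> C * (1 + x) powr (e - 1)"
    using C(2,3) assms(2,3) order_trans by (intro exI[of _ C]) blast
qed

lemma tame_plus1:
  assumes "tame f" shows "tame (\<lambda>x. f (x + 1))"
proof (rule tameI)
  fix e :: real assume e: "0 < e" "e < 1"
  obtain C where C: "C \<ge> 0" "\<And>x. 0 \<le> x \<Longrightarrow> \<bar>f x\<bar> \<le> C * (1 + x) powr e"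
    "\<And>x y. 0 \<le> x \<Longrightarrow> x \<le> y \<Longrightarrow> y \<le> x + 1 \<Longrightarrow> \<bar>f y - f x\<bar> \<le> C * (1 + x) powr (e - 1)"
    using tameE[OF assms e] by blast
  show "\<exists>C. \<forall>x y. 0 \<le> x \<and> x \<le> y \<and> y \<le> x + 1 \<longrightarrow>
     \<bar>f (x + 1)\<bar> \<le> C * (1 + x) powr e \<and> \<bar>f (y + 1) - f (x + 1)\<bar> \<le> C * (1 + x) powr (e - 1)"
  proof (intro exI[of _ "2 * C"] allI impI conjI)
    fix x y :: real assume xy: "0 \<le> x \<and> x \<le> y \<and> y \<le> x + 1"
    have "C * (1 + x) powr (e - 1) \<le> C * (1 + x) powr e"
      using C(1) xy by (intro mult_left_mono powr_mono) auto
    thus "\<bar>f (x + 1)\<bar> \<le> 2 * C * (1 + x) powr e" using C(2)[of x] C(3)[of x "x + 1"] xy by linarith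
    have "C * (2 + x) powr (e - 1) \<le> C * (1 + x) powr (e - 1)"
      using C(1) e xy by (intro mult_left_mono powr_mono2') auto
    moreover have "\<bar>f (y + 1) - f (x + 1)\<bar> \<le> C * (2 + x) powr (e - 1)"
      using C(3)[of "x + 1" "y + 1"] xy by (simp add: add_ac)
    moreover have "0 \<le> C * (1 + x) powr (e - 1)" using C(1) by simp
    ultimately show "\<bar>f (y + 1) - f (x + 1)\<bar> \<le> 2 * C * (1 + x) powr (e - 1)" by linarith
  qed
qed

text \<open>By monotonicity the increment up to \<open>y\<close> is at most that of a full unit
  step, which is \<open>1 / (x + 1) ^ m\<close>.\<close>

lemma tame_shifted_harm:
  assumes "m > 0" shows "tame (shifted_harm m)"
proof (rule tameI)
  fix e :: real assume e: "0 < e" "e < 1"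
  obtain C where C: "C \<ge> 0" "\<And>x. x \<ge> 0 \<Longrightarrow> shifted_harm m x \<le> C * x powr e"
    using shifted_harm_le_powr[of e m] e by auto
  show "\<exists>C. \<forall>x y. 0 \<le> x \<and> x \<le> y \<and> y \<le> x + 1 \<longrightarrow>
     \<bar>shifted_harm m x\<bar> \<le> C * (1 + x) powr e \<and>
     \<bar>shifted_harm m y - shifted_harm m x\<bar> \<le> C * (1 + x) powr (e - 1)"
  proof (intro exI[of _ "C + 1"] allI impI conjI)
    fix x y :: real assume xy: "0 \<le> x \<and> x \<le> y \<and> y \<le> x + 1"
    have "C * x powr e \<le> (C + 1) * (1 + x) powr e"
      using xy C(1) e by (intro mult_mono powr_mono2) auto
    thus "\<bar>shifted_harm m x\<bar> \<le> (C + 1) * (1 + x) powr e"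
      using C(2)[of x] shifted_harm_nonneg[of x m] xy by auto
    have "shifted_harm m y \<le> shifted_harm m x + 1 / (x + 1) ^ m"
      using shifted_harm_mono[of y "x + 1" m] shifted_harm_plus1[of x m] xy assms by auto
    hence "\<bar>shifted_harm m y - shifted_harm m x\<bar> \<le> 1 / (x + 1) ^ m"
      using shifted_harm_mono[of x y m] xy by auto
    also have "\<dots> \<le> 1 / (x + 1) ^ 1"
      using xy assms by (intro divide_left_mono power_increasing) auto
    also have "\<dots> = 1 * (1 + x) powr (-1)" using xy by (simp add: powr_minus_divide add.commute)
    also have "\<dots> \<le> (C + 1) * (1 + x) powr (e - 1)"
      using xy C e by (intro mult_mono powr_mono) auto
    finally show "\<bar>shifted_harm m y - shifted_harm m x\<bar> \<le> (C + 1) * (1 + x) powr (e - 1)" .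
  qed
qed

lemma tame_hsym:
  assumes "\<And>i. i > 0 \<Longrightarrow> tame (\<lambda>x. p x i)"
  shows "tame (\<lambda>x. hsym (p x) j)"
proof (induction j rule: less_induct)
  case (less j)
  show ?case
  proof (cases j)
    case (Suc l)
    have "tame (\<lambda>x. \<Sum>i\<le>l. p x (Suc i) * hsym (p x) (l - i))"
      by (intro tame_sum tame_mult assms less.IH) (auto simp: Suc)
    from tame_cmult[OF this, of "1 / real (Suc l)"] show ?thesis by (simp add: Suc hsym.simps(2))
  qed (auto intro: tame_const)
qed

lemma tame_complete_harm: "tame (complete_harm j)"
  unfolding complete_harm_def[abs_def] by (intro tame_hsym tame_shifted_harm)

lemma tame_elem_harm: "tame (elem_harm j)"
  unfolding elem_harm_def[abs_def] by (intro tame_hsym tame_cmult tame_shifted_harm)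

lemma tame_div_tendsto_0:
  assumes "tame f" "d \<ge> 0"
  shows "(\<lambda>n. f (real n + d) / (real n + c)) \<longlonglongrightarrow> 0"
proof -
  obtain C where C: "C \<ge> 0" "\<And>x. 0 \<le> x \<Longrightarrow> \<bar>f x\<bar> \<le> C * (1 + x) powr (1/2)"
    by (rule tameE[OF assms(1), of "1/2"]) simp_all
  have lim: "filterlim (\<lambda>n. b + real n) at_top sequentially" for b
    by (intro filterlim_tendsto_add_at_top[OF tendsto_const] filterlim_real_sequentially)
  have 1: "(\<lambda>n. C * ((1 + d) + real n) powr (-1/2)) \<longlonglongrightarrow> 0"
    by (intro tendsto_mult_right_zero tendsto_neg_powr lim) auto
  have 2: "(\<lambda>n. f (real n + d) / ((1 + d) + real n)) \<longlonglongrightarrow> 0"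
  proof (rule Lim_null_comparison[OF always_eventually 1], intro allI)
    fix n
    have "\<bar>f (real n + d)\<bar> / ((1 + d) + real n) \<le> C * (1 + (real n + d)) powr (1/2) / ((1 + d) + real n)"
      using C(2)[of "real n + d"] assms by (intro divide_right_mono) auto
    also have "\<dots> = C * ((1 + d) + real n) powr (1/2 - 1)"
      using assms by (simp only: powr_diff) (simp add: add_ac)
    finally show "norm (f (real n + d) / ((1 + d) + real n)) \<le> C * ((1 + d) + real n) powr (-1/2)"
      using assms by simp
  qed
  \<comment> \<open>This factor equals (1 + d + n)/(c + n) and exchanges the denominators. Since
    \<open>c\<close> may be negative, the equality holds only for large \<open>n\<close>.\<close>
  have "(\<lambda>n. 1 + (1 + d - c) / (c + real n)) \<longlonglongrightarrow> 1 + 0"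
    by (intro tendsto_intros tendsto_divide_0[OF tendsto_const] filterlim_at_top_imp_at_infinity lim)
  from tendsto_mult[OF 2 this]
  have "(\<lambda>n. f (real n + d) / ((1 + d) + real n) * (1 + (1 + d - c) / (c + real n))) \<longlonglongrightarrow> 0" by simp
  moreover have "\<forall>\<^sub>F n in sequentially. f (real n + d) / ((1 + d) + real n) * (1 + (1 + d - c) / (c + real n))
     = f (real n + d) / (real n + c)"
    using eventually_gt_at_top[of "nat \<lceil>\<bar>c\<bar>\<rceil>"]
  proof eventually_elim
    case (elim n)
    hence "real n > \<bar>c\<bar>" by linarith
    hence "c + real n > 0" "1 + d + real n > 0" using assms by linarith+
    moreover from this have "1 + (1 + d - c) / (c + real n) = (1 + d + real n) / (c + real n)"
      by (simp add: field_simps)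
    ultimately show ?case by (simp add: add.commute)
  qed
  ultimately show ?thesis by (rule Lim_transform_eventually)
qed

section \<open>Two closed-form series\<close>

text \<open>With N = n + 1 the argument of \<open>f\<close> is N + d - 1, as the identity for
  elementary functions requires; complete functions enter as
  \<open>\<lambda>x. complete_harm j (x + 1)\<close>. The kernel equals d/(N(N + d)).\<close>

definition kernel_sum :: "(real \<Rightarrow> real) \<Rightarrow> real \<Rightarrow> real" where
  "kernel_sum f d = (\<Sum>n. f (real n + d) * (1 / real (Suc n) - 1 / (real (Suc n) + d)))"

text \<open>Both majorants are summable in \<open>n\<close>. The first is linear in \<open>d\<close>
  and controls the sum near 0; the second decays in \<open>x\<close> and controls its variation at
  infinity. Both come from tameness with exponent 1/2.\<close>

lemma kernel_sum_bounds:
  assumes "tame f"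
  obtains C where "C \<ge> 0"
    "\<And>d n. d \<ge> 0 \<Longrightarrow> \<bar>f (real n + d) * (1 / real (Suc n) - 1 / (real (Suc n) + d))\<bar>
         \<le> C * d * real (Suc n) powr (-3/2)"
    "\<And>x y n. 0 \<le> x \<Longrightarrow> x \<le> y \<Longrightarrow> y \<le> x + 1 \<Longrightarrow>
       \<bar>f (real n + y) * (1 / real (Suc n) - 1 / (real (Suc n) + y))
        - f (real n + x) * (1 / real (Suc n) - 1 / (real (Suc n) + x))\<bar>
         \<le> C * (1 + x) powr (-1/4) * real (Suc n) powr (-5/4)"
proof -
  obtain C where C: "C \<ge> 0" "\<And>x. 0 \<le> x \<Longrightarrow> \<bar>f x\<bar> \<le> C * (1 + x) powr (1/2)"
    "\<And>x y. 0 \<le> x \<Longrightarrow> x \<le> y \<Longrightarrow> y \<le> x + 1 \<Longrightarrow> \<bar>f y - f x\<bar> \<le> C * (1 + x) powr (1/2 - 1)"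
    by (rule tameE[OF assms(1), of "1/2"]) simp_all
  show ?thesis
  proof (rule that[of "2 * C"])
    show "2 * C \<ge> 0" using C by simp
  next
    fix d :: real and n :: nat assume d: "d \<ge> 0"
    define N where "N = real (Suc n)"
    have N: "N \<ge> 1" "real n = N - 1" by (auto simp: N_def)
    have eq: "1 / N - 1 / (N + d) = d / N * (1 / (N + d))" using N d by (simp add: field_simps)
    have "\<bar>f (real n + d) * (1 / N - 1 / (N + d))\<bar> = \<bar>f (real n + d)\<bar> * (d / N * (1 / (N + d)))"
      unfolding eq using N d by (simp add: abs_mult)
    also have "\<dots> \<le> (C * (N + d) powr (1/2)) * (d / N * (1 / (N + d)))"
      using C(2)[of "real n + d"] N d by (intro mult_right_mono) auto
    also have "\<dots> = C * d / N * (N + d) powr (1/2 - 1)"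
      using N d by (simp only: powr_diff) simp
    also have "\<dots> \<le> C * d / N * N powr (1/2 - 1)"
      using N d C by (intro mult_left_mono powr_mono2') auto
    also have "\<dots> = C * d * (N powr (-1/2) * N powr (-1))"
      using N by (simp add: powr_minus_divide)
    also have "\<dots> = C * d * N powr (-3/2)"
      by (simp only: powr_add[symmetric]) simp
    also have "\<dots> \<le> 2 * C * d * N powr (-3/2)" using C d by (intro mult_right_mono) auto
    finally show "\<bar>f (real n + d) * (1 / real (Suc n) - 1 / (real (Suc n) + d))\<bar>
         \<le> 2 * C * d * real (Suc n) powr (-3/2)" unfolding N_def .
  next
    fix x y :: real and n :: nat assume xy: "0 \<le> x" "x \<le> y" "y \<le> x + 1"
    define N where "N = real (Suc n)"
    have N: "N \<ge> 1" "real n = N - 1" by (auto simp: N_def)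
    have 1: "\<bar>f (real n + y) - f (real n + x)\<bar> * (1 / N - 1 / (N + y)) \<le> C * (N + x) powr (-1/2) * (1 / N)"
      using C(3)[of "real n + x" "real n + y"] N xy C(1) by (intro mult_mono) (auto intro!: divide_left_mono)
    have "\<bar>f (real n + x)\<bar> * (1 / (N + x) - 1 / (N + y)) \<le> C * (N + x) powr (1/2) * (1 / (N + x) * (1 / N))"
    proof (intro mult_mono)
      have "1 / (N + x) - 1 / (N + y) = (y - x) * (1 / (N + x) * (1 / (N + y)))"
        using N xy by (simp add: field_simps)
      also have "\<dots> \<le> 1 * (1 / (N + x) * (1 / N))"
        using N xy by (intro mult_mono divide_left_mono) auto
      finally show "1 / (N + x) - 1 / (N + y) \<le> 1 / (N + x) * (1 / N)" by simp
    qed (use C(2)[of "real n + x"] N xy C(1) in \<open>auto intro!: divide_left_mono\<close>)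
    also have "\<dots> = C * (N + x) powr (1/2 - 1) * (1 / N)"
      using N xy by (simp only: powr_diff) simp
    finally have 2: "\<bar>f (real n + x)\<bar> * (1 / (N + x) - 1 / (N + y)) \<le> C * (N + x) powr (-1/2) * (1 / N)" by simp
    \<comment> \<open>Discrete product rule: first the increment of \<open>f\<close>, then that of
      the kernel. Each part contributes \<open>C\<close>, whence \<open>2 * C\<close>.\<close>
    have "f (real n + y) * (1 / N - 1 / (N + y)) - f (real n + x) * (1 / N - 1 / (N + x))
       = (f (real n + y) - f (real n + x)) * (1 / N - 1 / (N + y))
         + f (real n + x) * (1 / (N + x) - 1 / (N + y))"
      by (simp add: algebra_simps)
    also have "\<bar>\<dots>\<bar> \<le> \<bar>f (real n + y) - f (real n + x)\<bar> * (1 / N - 1 / (N + y))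
         + \<bar>f (real n + x)\<bar> * (1 / (N + x) - 1 / (N + y))"
    proof -
      have "\<bar>a * u + b * v\<bar> \<le> \<bar>a\<bar> * u + \<bar>b\<bar> * v" if "u \<ge> 0" "v \<ge> 0" for a b u v :: real
        using abs_triangle_ineq[of "a * u" "b * v"] that by (simp add: abs_mult)
      moreover have "1 / N - 1 / (N + y) \<ge> 0" "1 / (N + x) - 1 / (N + y) \<ge> 0"
        using N xy by (auto intro!: divide_left_mono)
      ultimately show ?thesis by blast
    qed
    also have "\<dots> \<le> 2 * C * (N + x) powr (-1/2) * (1 / N)" using 1 2 by linarith
    \<comment> \<open>One quarter power is kept for the decay in \<open>x\<close>; the other joins
      \<open>1 / N\<close> to give the summable exponent -5/4.\<close>
    also have "(N + x) powr (-1/2) = (N + x) powr (-1/4) * (N + x) powr (-1/4)"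
      by (simp flip: powr_add)
    also have "2 * C * ((N + x) powr (-1/4) * (N + x) powr (-1/4)) * (1 / N)
        \<le> 2 * C * ((1 + x) powr (-1/4) * N powr (-1/4)) * (1 / N)"
      using N xy C(1) by (intro mult_mono mult_left_mono powr_mono2' mult_right_mono) auto
    also have "\<dots> = 2 * C * (1 + x) powr (-1/4) * (N powr (-1/4) * N powr (-1))"
      using N by (simp add: powr_minus_divide)
    also have "N powr (-1/4) * N powr (-1) = N powr (-5/4)"
      by (simp only: powr_add[symmetric]) simp
    finally show "\<bar>f (real n + y) * (1 / real (Suc n) - 1 / (real (Suc n) + y))
        - f (real n + x) * (1 / real (Suc n) - 1 / (real (Suc n) + x))\<bar>
         \<le> 2 * C * (1 + x) powr (-1/4) * real (Suc n) powr (-5/4)" unfolding N_def .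
  qed
qed

lemma kernel_sum_sums:
  assumes "tame f" "d \<ge> 0"
  shows "(\<lambda>n. f (real n + d) * (1 / real (Suc n) - 1 / (real (Suc n) + d))) sums kernel_sum f d"
proof -
  from assms(1) obtain C where C: "\<And>d n. d \<ge> 0 \<Longrightarrow> \<bar>f (real n + d) * (1 / real (Suc n) - 1 / (real (Suc n) + d))\<bar>
         \<le> C * d * real (Suc n) powr (-3/2)" by (rule kernel_sum_bounds) blast
  have "summable (\<lambda>n. C * d * real (Suc n) powr (-3/2))"
    using summable_mult[OF summable_Suc_powr[of "3/2"]] by simp
  hence "summable (\<lambda>n. f (real n + d) * (1 / real (Suc n) - 1 / (real (Suc n) + d)))"
    by (rule summable_comparison_test[rotated]) (use C[OF assms(2)] in auto)
  thus ?thesis unfolding kernel_sum_def by (rule summable_sums)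
qed

section \<open>Slow variation, behaviour at 0, and vanishing of periodic functions\<close>

text \<open>Weaker than \<open>tame\<close>: growth is not controlled. The exponent is the one that
  \<open>kernel_sum_bounds\<close> supplies for kernel sums.\<close>

definition slow :: "(real \<Rightarrow> real) \<Rightarrow> bool" where
  "slow f \<longleftrightarrow> (\<exists>C. \<forall>x y. 0 \<le> x \<and> x \<le> y \<and> y \<le> x + 1 \<longrightarrow> \<bar>f y - f x\<bar> \<le> C * (1 + x) powr (-1/4))"

definition linear_at_0 :: "(real \<Rightarrow> real) \<Rightarrow> bool" where
  "linear_at_0 f \<longleftrightarrow> (\<exists>C. \<forall>x. 0 < x \<and> x \<le> 1 \<longrightarrow> \<bar>f x\<bar> \<le> C * x)"

lemma slow_kernel_sum:
  assumes "tame f" shows "slow (kernel_sum f)"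
proof -
  from assms obtain C where C: "C \<ge> 0" "\<And>x y n. 0 \<le> x \<Longrightarrow> x \<le> y \<Longrightarrow> y \<le> x + 1 \<Longrightarrow>
       \<bar>f (real n + y) * (1 / real (Suc n) - 1 / (real (Suc n) + y))
        - f (real n + x) * (1 / real (Suc n) - 1 / (real (Suc n) + x))\<bar>
         \<le> C * (1 + x) powr (-1/4) * real (Suc n) powr (-5/4)" by (rule kernel_sum_bounds) blast
  define Z where "Z = (\<Sum>n. real (Suc n) powr (-5/4))"
  have Z: "(\<lambda>n. real (Suc n) powr (-5/4)) sums Z"
    unfolding Z_def using summable_sums[OF summable_Suc_powr[of "5/4"]] by simp
  have "\<bar>kernel_sum f y - kernel_sum f x\<bar> \<le> C * Z * (1 + x) powr (-1/4)" if xy: "0 \<le> x" "x \<le> y" "y \<le> x + 1" for x y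
  proof -
    have "norm (kernel_sum f y - kernel_sum f x) \<le> C * (1 + x) powr (-1/4) * Z"
      by (rule norm_sums_le[OF sums_diff[OF kernel_sum_sums kernel_sum_sums] sums_mult[OF Z]])
         (use assms xy C(2)[OF xy] in auto)
    thus ?thesis by (simp add: mult_ac)
  qed
  thus ?thesis unfolding slow_def by blast
qed

lemma linear_at_0_kernel_sum:
  assumes "tame f" shows "linear_at_0 (kernel_sum f)"
proof -
  from assms obtain C where C: "C \<ge> 0" "\<And>d n. d \<ge> 0 \<Longrightarrow> \<bar>f (real n + d) * (1 / real (Suc n) - 1 / (real (Suc n) + d))\<bar>
         \<le> C * d * real (Suc n) powr (-3/2)" by (rule kernel_sum_bounds) blast
  define Z where "Z = (\<Sum>n. real (Suc n) powr (-3/2))"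
  have Z: "(\<lambda>n. real (Suc n) powr (-3/2)) sums Z"
    unfolding Z_def using summable_sums[OF summable_Suc_powr[of "3/2"]] by simp
  have "\<bar>kernel_sum f x\<bar> \<le> C * Z * x" if x: "0 < x" for x
  proof -
    have "norm (kernel_sum f x) \<le> C * x * Z"
      by (rule norm_sums_le[OF kernel_sum_sums sums_mult[OF Z]]) (use assms x C(2)[of x] in auto)
    thus ?thesis by (simp add: mult_ac)
  qed
  thus ?thesis unfolding linear_at_0_def by blast
qed

text \<open>Taking \<open>e = 3/4\<close> makes \<open>e - 1\<close> equal to -1/4.\<close>

lemma slow_tame:
  assumes "tame f" shows "slow f"
  by (rule tameE[OF assms, of "3/4"]) (auto simp: slow_def)

lemma slow_diff:
  assumes "slow f" "slow g" shows "slow (\<lambda>x. f x - g x)"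
proof -
  from assms(1) obtain C where C: "\<And>x y. 0 \<le> x \<Longrightarrow> x \<le> y \<Longrightarrow> y \<le> x + 1 \<Longrightarrow> \<bar>f y - f x\<bar> \<le> C * (1 + x) powr (-1/4)"
    unfolding slow_def by blast
  from assms(2) obtain B where B: "\<And>x y. 0 \<le> x \<Longrightarrow> x \<le> y \<Longrightarrow> y \<le> x + 1 \<Longrightarrow> \<bar>g y - g x\<bar> \<le> B * (1 + x) powr (-1/4)"
    unfolding slow_def by blast
  have "\<bar>f y - g y - (f x - g x)\<bar> \<le> (C + B) * (1 + x) powr (-1/4)" if "0 \<le> x" "x \<le> y" "y \<le> x + 1" for x y
    using C[OF that] B[OF that] unfolding distrib_right by linarith
  thus ?thesis unfolding slow_def by blast
qed

lemma linear_at_0_diff: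
  assumes "linear_at_0 f" "linear_at_0 g" shows "linear_at_0 (\<lambda>x. f x - g x)"
proof -
  from assms(1) obtain C where C: "\<And>x. 0 < x \<Longrightarrow> x \<le> 1 \<Longrightarrow> \<bar>f x\<bar> \<le> C * x"
    unfolding linear_at_0_def by blast
  from assms(2) obtain B where B: "\<And>x. 0 < x \<Longrightarrow> x \<le> 1 \<Longrightarrow> \<bar>g x\<bar> \<le> B * x"
    unfolding linear_at_0_def by blast
  have "\<bar>f x - g x\<bar> \<le> (C + B) * x" if "0 < x" "x \<le> 1" for x
    using C[OF that] B[OF that] unfolding distrib_right by linarith
  thus ?thesis unfolding linear_at_0_def by blast
qed

text \<open>A tame function is bounded on [0,1], by its value at 0 plus one increment.\<close>

lemma linear_at_0_mult_tame:
  assumes "linear_at_0 f" "tame g" shows "linear_at_0 (\<lambda>x. f x * g x)"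
proof -
  from assms(1) obtain C where C: "\<And>x. 0 < x \<Longrightarrow> x \<le> 1 \<Longrightarrow> \<bar>f x\<bar> \<le> C * x"
    unfolding linear_at_0_def by blast
  obtain B where B: "B \<ge> 0" "\<And>x y. 0 \<le> x \<Longrightarrow> x \<le> y \<Longrightarrow> y \<le> x + 1 \<Longrightarrow> \<bar>g y - g x\<bar> \<le> B * (1 + x) powr (1/2 - 1)"
    by (rule tameE[OF assms(2), of "1/2"]) simp_all
  have "\<bar>f x * g x\<bar> \<le> C * (\<bar>g 0\<bar> + B) * x" if x: "0 < x" "x \<le> 1" for x
  proof -
    have "\<bar>g x\<bar> \<le> \<bar>g 0\<bar> + B" using B(2)[of 0 x] x by simp
    hence "\<bar>f x\<bar> * \<bar>g x\<bar> \<le> (C * x) * (\<bar>g 0\<bar> + B)" using C[OF x] B(1) by (intro mult_mono) auto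
    thus ?thesis by (simp add: abs_mult mult_ac)
  qed
  thus ?thesis unfolding linear_at_0_def by blast
qed

lemma linear_at_0_sum:
  assumes "finite A" "\<And>i. i \<in> A \<Longrightarrow> linear_at_0 (f i)" shows "linear_at_0 (\<lambda>x. \<Sum>i\<in>A. f i x)"
  using assms
proof (induction A rule: finite_induct)
  case empty
  show ?case by (auto simp: linear_at_0_def intro: exI[of _ 0])
next
  case (insert i A)
  have "linear_at_0 (\<lambda>x. 0)" by (auto simp: linear_at_0_def intro: exI[of _ 0])
  from linear_at_0_diff[OF insert.prems[of i] linear_at_0_diff[OF this insert.IH]] insert.prems
  have "linear_at_0 (\<lambda>x. f i x - (0 - (\<Sum>i\<in>A. f i x)))" by simp
  thus ?case using insert.hyps by simp
qed

lemma linear_at_0_shifted_harm: "linear_at_0 (shifted_harm m)"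
proof -
  obtain C where "\<And>x. x \<ge> 0 \<Longrightarrow> shifted_harm m x \<le> C * x powr 1"
    using shifted_harm_le_powr[of 1 m] by auto
  thus ?thesis unfolding linear_at_0_def using shifted_harm_nonneg[of _ m] by (intro exI[of _ C]) auto
qed

text \<open>Periodicity moves two nearby points up by \<open>N\<close>, where slow variation makes
  the difference of their values arbitrarily small. Hence \<open>D\<close> is constant on the
  positive reals, and its bound near 0 forces the constant to be 0.\<close>

lemma periodic_slow_linear_at_0_zero:
  assumes "slow D" "linear_at_0 D" and per: "\<And>x. x > 0 \<Longrightarrow> D (x + 1) = D x" and "x > 0"
  shows "D x = 0"
proof -
  have perN: "D (x + real N) = D x" if "x > 0" for x N
  proof (induction N)
    case (Suc N)
    thus ?case using per[of "x + real N"] that by (simp add: add_ac)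
  qed simp
  from assms(1) obtain C where C: "\<And>x y. 0 \<le> x \<Longrightarrow> x \<le> y \<Longrightarrow> y \<le> x + 1 \<Longrightarrow> \<bar>D y - D x\<bar> \<le> C * (1 + x) powr (-1/4)"
    unfolding slow_def by blast
  from assms(2) obtain B where B: "\<And>x. 0 < x \<Longrightarrow> x \<le> 1 \<Longrightarrow> \<bar>D x\<bar> \<le> B * x"
    unfolding linear_at_0_def by blast
  have near: "D y = D x" if xy: "0 < x" "x \<le> y" "y \<le> x + 1" for x y
  proof -
    have "(\<lambda>N. C * ((1 + x) + real N) powr (-1/4)) \<longlonglongrightarrow> 0"
      by (intro tendsto_mult_right_zero tendsto_neg_powr
          filterlim_tendsto_add_at_top[OF tendsto_const] filterlim_real_sequentially) auto
    moreover have "\<bar>D y - D x\<bar> \<le> C * ((1 + x) + real N) powr (-1/4)" for N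
      using C[of "x + real N" "y + real N"] perN[of x N] perN[of y N] xy by (simp add: add_ac)
    ultimately have "\<bar>D y - D x\<bar> \<le> 0" by (intro LIMSEQ_le_const) auto
    thus ?thesis by simp
  qed
  \<comment> \<open>Subtracting the integer part of \<open>x - y\<close> brings \<open>x\<close>
    into the unit interval above \<open>y\<close>.\<close>
  have const: "D x = D y" if "0 < y" "y \<le> 1" for y
  proof (cases "x \<ge> y")
    case True
    define N where "N = nat \<lfloor>x - y\<rfloor>"
    have "y \<le> x - real N" "x - real N \<le> y + 1" using True unfolding N_def by linarith+
    thus ?thesis using near[of y "x - real N"] perN[of "x - real N" N] that by simp
  next
    case False
    thus ?thesis using near[of x y] assms that by simp
  qed
  have "(\<lambda>n. B * (1 / real (Suc n))) \<longlonglongrightarrow> B * 0"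
    by (intro tendsto_mult tendsto_const LIMSEQ_Suc[OF lim_1_over_n])
  moreover have "\<bar>D x\<bar> \<le> B * (1 / real (Suc n))" for n
    using B[of "1 / real (Suc n)"] const[of "1 / real (Suc n)"] by simp
  ultimately have "\<bar>D x\<bar> \<le> B * 0" by (intro LIMSEQ_le_const) auto
  thus ?thesis by simp
qed

section \<open>The series of complete symmetric functions\<close>

text \<open>The parts of the kernels with denominators depending on \<open>d\<close> telescope as
  \<open>g (Suc n) - g n\<close>, leaving the boundary term and a series of unit increments of
  \<open>f\<close>. A recurrence for \<open>f\<close> then reduces that series to a lower
  index.\<close>

lemma kernel_sum_plus1:
  assumes "tame f" "d \<ge> 0"
  shows "(\<lambda>n. (f (real n + d + 1) - f (real n + d)) / real (Suc n)) sums
           (kernel_sum f (d + 1) - kernel_sum f d - f d / (1 + d))"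
proof -
  define g where "g n = f (real n + d) / (real n + (1 + d))" for n
  have "g \<longlonglongrightarrow> 0" unfolding g_def using assms by (rule tame_div_tendsto_0)
  from telescope_sums[OF this] have "(\<lambda>n. g (Suc n) - g n) sums (- f d / (1 + d))" by (simp add: g_def)
  from sums_add[OF sums_diff[OF kernel_sum_sums[of f "d + 1"] kernel_sum_sums[of f d]] this] assms
  have "(\<lambda>n. (f (real n + (d + 1)) * (1 / real (Suc n) - 1 / (real (Suc n) + (d + 1))) -
      f (real n + d) * (1 / real (Suc n) - 1 / (real (Suc n) + d))) + (g (Suc n) - g n)) sums
     (kernel_sum f (d + 1) - kernel_sum f d + - f d / (1 + d))" by simp
  moreover have "(f (real n + (d + 1)) * (1 / real (Suc n) - 1 / (real (Suc n) + (d + 1))) -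
      f (real n + d) * (1 / real (Suc n) - 1 / (real (Suc n) + d))) + (g (Suc n) - g n)
     = (f (real n + d + 1) - f (real n + d)) / real (Suc n)" for n
  proof -
    have 1: "g n = f (real n + d) * (1 / (real (Suc n) + d))" by (simp add: g_def add_ac)
    have 2: "g (Suc n) = f (real n + d + 1) * (1 / (real (Suc n) + (d + 1)))"
      by (simp add: g_def add_ac)
    show ?thesis unfolding 1 2 by (simp add: algebra_simps diff_divide_distrib)
  qed
  ultimately show ?thesis by (simp add: algebra_simps)
qed

lemma kernel_sum_complete_harm:
  assumes "d > 0"
  shows "kernel_sum (\<lambda>x. complete_harm j (x + 1)) d = real (Suc j) * complete_harm (Suc j) d"
  using assms
proof (induction j arbitrary: d)
  case 0
  thus ?case by (simp add: kernel_sum_def complete_harm_def hsym.simps(2) shifted_harm_def)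
next
  case (Suc j)
  let ?D = "\<lambda>d. kernel_sum (\<lambda>x. complete_harm (Suc j) (x + 1)) d - real (Suc (Suc j)) * complete_harm (Suc (Suc j)) d"
  have "?D d = 0"
  proof (rule periodic_slow_linear_at_0_zero[of ?D])
    show "slow ?D" by (intro slow_diff slow_kernel_sum slow_tame tame_cmult tame_complete_harm tame_plus1)
    \<comment> \<open>By Newton's recursion this sum is \<open>(j + 2)\<close> times the next
      complete function; every summand has a power sum as a factor and so vanishes linearly at
      0.\<close>
    have "linear_at_0 (\<lambda>d. \<Sum>i\<le>Suc j. shifted_harm (Suc i) d * complete_harm (Suc j - i) d)"
      by (intro linear_at_0_sum linear_at_0_mult_tame linear_at_0_shifted_harm tame_complete_harm) auto
    hence "linear_at_0 (\<lambda>d. real (Suc (Suc j)) * complete_harm (Suc (Suc j)) d)"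
      by (simp add: complete_harm_def hsym.simps(2)[of _ "Suc j"] del: of_nat_Suc)
    thus "linear_at_0 ?D" by (intro linear_at_0_diff linear_at_0_kernel_sum tame_complete_harm tame_plus1)
    fix d :: real assume d: "d > 0"
    have "(\<lambda>n. (complete_harm (Suc j) (real n + d + 1 + 1) - complete_harm (Suc j) (real n + d + 1)) / real (Suc n)) sums
       (kernel_sum (\<lambda>x. complete_harm (Suc j) (x + 1)) (d + 1) - kernel_sum (\<lambda>x. complete_harm (Suc j) (x + 1)) d - complete_harm (Suc j) (d + 1) / (1 + d))"
      using kernel_sum_plus1[of "\<lambda>x. complete_harm (Suc j) (x + 1)" d] d by (simp add: tame_plus1 tame_complete_harm)
    moreover have "(\<lambda>n. complete_harm j (real n + (d + 1) + 1) * (1 / real (Suc n) - 1 / (real (Suc n) + (d + 1))) / (d + 1))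
        sums (kernel_sum (\<lambda>x. complete_harm j (x + 1)) (d + 1) / (d + 1))"
      using d by (intro sums_divide kernel_sum_sums tame_plus1 tame_complete_harm) auto
    moreover have "(complete_harm (Suc j) (real n + d + 1 + 1) - complete_harm (Suc j) (real n + d + 1)) / real (Suc n)
       = complete_harm j (real n + (d + 1) + 1) * (1 / real (Suc n) - 1 / (real (Suc n) + (d + 1))) / (d + 1)" for n
    proof -
      \<comment> \<open>The recurrence brings the denominator n + d + 2, so the lower series appears
        at \<open>d + 1\<close>, divided by \<open>d + 1\<close>.\<close>
      have "1 / real (Suc n) - 1 / (real (Suc n) + (d + 1)) = (d + 1) / (real (Suc n) * (real n + d + 1 + 1))"
        using d by (simp add: field_simps)
      thus ?thesis using d complete_harm_plus1[of "real n + d + 1" j] by (simp add: add_ac)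
    qed
    ultimately have "kernel_sum (\<lambda>x. complete_harm (Suc j) (x + 1)) (d + 1) - kernel_sum (\<lambda>x. complete_harm (Suc j) (x + 1)) d
        - complete_harm (Suc j) (d + 1) / (1 + d) = kernel_sum (\<lambda>x. complete_harm j (x + 1)) (d + 1) / (d + 1)"
      using sums_unique2 by simp
    also have "\<dots> = real (Suc j) * complete_harm (Suc j) (d + 1) / (d + 1)" using Suc.IH[of "d + 1"] d by simp
    \<comment> \<open>The boundary term raises the factor \<open>j + 1\<close> of the induction
      hypothesis to \<open>j + 2\<close>, matching the increment of the closed form.\<close>
    finally show "?D (d + 1) = ?D d"
      using complete_harm_plus1[of d "Suc j"] d by (simp add: algebra_simps add_divide_distrib)
  qed (use Suc in auto)
  thus ?case by simp
qed

section \<open>The series of elementary symmetric functions\<close>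

text \<open>The function T_i of the overview as a series with terms d/(N^(i+1) (N + d)). This form
  shows monotonicity and the behaviour at 0, which the recurrence with its division by
  \<open>d\<close> hides.\<close>

definition zeta_kernel :: "nat \<Rightarrow> real \<Rightarrow> real" where
  "zeta_kernel i d = (\<Sum>n. (1 / real (Suc n) - 1 / (real (Suc n) + d)) / real (Suc n) ^ i)"

lemma zeta_kernel_0: "zeta_kernel 0 d = shifted_harm 1 d"
  by (simp add: zeta_kernel_def shifted_harm_def)

lemma zeta_kernel_sums:
  assumes "d \<ge> 0"
  shows "(\<lambda>n. (1 / real (Suc n) - 1 / (real (Suc n) + d)) / real (Suc n) ^ i) sums zeta_kernel i d"
proof -
  have "summable (\<lambda>n. (1 / real (Suc n) - 1 / (real (Suc n) + d)) / real (Suc n) ^ i)"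
  proof (rule summable_comparison_test[OF _ summable_shifted_harm[OF assms, of 1]], intro exI allI impI)
    fix n
    have "(1 / real (Suc n) - 1 / (real (Suc n) + d)) / real (Suc n) ^ i \<le> (1 / real (Suc n) - 1 / (real (Suc n) + d)) / 1"
      using assms by (intro divide_left_mono) (auto intro!: divide_left_mono)
    moreover have "0 \<le> (1 / real (Suc n) - 1 / (real (Suc n) + d)) / real (Suc n) ^ i"
      using assms by (intro divide_nonneg_pos) (auto intro!: divide_left_mono)
    ultimately show "norm ((1 / real (Suc n) - 1 / (real (Suc n) + d)) / real (Suc n) ^ i)
        \<le> 1 / real (Suc n) ^ 1 - 1 / (real (Suc n) + d) ^ 1" by simp
  qed
  thus ?thesis unfolding zeta_kernel_def by (rule summable_sums)
qed

text \<open>Termwise, 1/N^(i+2) - 1/(N^(i+1) (N + d)) = d/(N^(i+2) (N + d)).\<close>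

lemma zeta_kernel_Suc:
  assumes "d > 0"
  shows "zeta_kernel (Suc i) d = zeta_nat (i + 2) - zeta_kernel i d / d"
proof -
  have "(\<lambda>n. 1 / real (Suc n) ^ (i + 2)) sums zeta_nat (i + 2)"
    unfolding zeta_nat_def by (intro summable_sums summable_inverse_Suc_power) simp
  from sums_diff[OF this sums_divide[OF zeta_kernel_sums[of d i]]] assms
  have "(\<lambda>n. 1 / real (Suc n) ^ (i + 2) - (1 / real (Suc n) - 1 / (real (Suc n) + d)) / real (Suc n) ^ i / d)
      sums (zeta_nat (i + 2) - zeta_kernel i d / d)" by simp
  moreover have "1 / N ^ (i + 2) - (1 / N - 1 / (N + d)) / N ^ i / d = (1 / N - 1 / (N + d)) / N ^ Suc i"
    if "N > 0" for N :: real
    using that assms by (simp add: divide_simps)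
  ultimately have "(\<lambda>n. (1 / real (Suc n) - 1 / (real (Suc n) + d)) / real (Suc n) ^ Suc i)
      sums (zeta_nat (i + 2) - zeta_kernel i d / d)" by (simp del: of_nat_Suc power_Suc)
  thus ?thesis using zeta_kernel_sums[of d "Suc i"] assms sums_unique2 by auto
qed

text \<open>The terms have nonnegative increments, divided by N^i \<ge> 1. Tameness and linearity at
  0 thus carry over from \<open>shifted_harm 1\<close>.\<close>

lemma zeta_kernel_diff_bounds:
  assumes "0 \<le> x" "x \<le> y"
  shows "0 \<le> zeta_kernel i y - zeta_kernel i x" "zeta_kernel i y - zeta_kernel i x \<le> shifted_harm 1 y - shifted_harm 1 x"
proof -
  have s: "(\<lambda>n. (1 / real (Suc n) - 1 / (real (Suc n) + y)) / real (Suc n) ^ i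
      - (1 / real (Suc n) - 1 / (real (Suc n) + x)) / real (Suc n) ^ i) sums (zeta_kernel i y - zeta_kernel i x)"
    using assms by (intro sums_diff zeta_kernel_sums) auto
  have t: "(\<lambda>n. (1 / real (Suc n) ^ 1 - 1 / (real (Suc n) + y) ^ 1)
      - (1 / real (Suc n) ^ 1 - 1 / (real (Suc n) + x) ^ 1)) sums (shifted_harm 1 y - shifted_harm 1 x)"
    using assms by (intro sums_diff shifted_harm_sums) auto
  have eq: "(1 / real (Suc n) - 1 / (real (Suc n) + y)) / real (Suc n) ^ i
      - (1 / real (Suc n) - 1 / (real (Suc n) + x)) / real (Suc n) ^ i
    = (1 / (real (Suc n) + x) - 1 / (real (Suc n) + y)) / real (Suc n) ^ i" for n
    by (simp add: diff_divide_distrib)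
  have nn: "0 \<le> 1 / (real (Suc n) + x) - 1 / (real (Suc n) + y)" for n
    using assms by (auto intro!: divide_left_mono)
  show "0 \<le> zeta_kernel i y - zeta_kernel i x"
    by (rule sums_le[OF _ sums_zero s]) (unfold eq, use nn in \<open>auto simp del: of_nat_Suc\<close>)
  show "zeta_kernel i y - zeta_kernel i x \<le> shifted_harm 1 y - shifted_harm 1 x"
  proof (rule sums_le[OF _ s t])
    fix n
    have "(1 / (real (Suc n) + x) - 1 / (real (Suc n) + y)) / real (Suc n) ^ i
        \<le> (1 / (real (Suc n) + x) - 1 / (real (Suc n) + y)) / 1"
      using nn[of n] by (intro divide_left_mono) auto
    thus "(1 / real (Suc n) - 1 / (real (Suc n) + y)) / real (Suc n) ^ i
      - (1 / real (Suc n) - 1 / (real (Suc n) + x)) / real (Suc n) ^ i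
      \<le> (1 / real (Suc n) ^ 1 - 1 / (real (Suc n) + y) ^ 1) - (1 / real (Suc n) ^ 1 - 1 / (real (Suc n) + x) ^ 1)"
      unfolding eq by simp
  qed
qed

lemma zeta_kernel_at_0: "zeta_kernel i 0 = 0"
  by (simp add: zeta_kernel_def)

lemma tame_zeta_kernel: "tame (zeta_kernel i)"
proof (rule tame_dominated[of "shifted_harm 1"])
  show "\<bar>zeta_kernel i x\<bar> \<le> \<bar>shifted_harm 1 x\<bar>" if "0 \<le> x" for x
    using zeta_kernel_diff_bounds[of 0 x i] that by (simp add: zeta_kernel_at_0 shifted_harm_0)
  show "\<bar>zeta_kernel i y - zeta_kernel i x\<bar> \<le> \<bar>shifted_harm 1 y - shifted_harm 1 x\<bar>" if "0 \<le> x" "x \<le> y" for x y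
    using zeta_kernel_diff_bounds[OF that, of i] by simp
qed (rule tame_shifted_harm, simp)

lemma linear_at_0_zeta_kernel: "linear_at_0 (zeta_kernel i)"
proof -
  from linear_at_0_shifted_harm[of 1] obtain C where C: "\<And>x. 0 < x \<Longrightarrow> x \<le> 1 \<Longrightarrow> \<bar>shifted_harm 1 x\<bar> \<le> C * x"
    unfolding linear_at_0_def by blast
  have "\<bar>zeta_kernel i x\<bar> \<le> C * x" if "0 < x" "x \<le> 1" for x
    using zeta_kernel_diff_bounds[of 0 x i] C[OF that] that by (simp add: zeta_kernel_at_0 shifted_harm_0)
  thus ?thesis unfolding linear_at_0_def by blast
qed

definition elem_kernel :: "nat \<Rightarrow> real \<Rightarrow> real" where
  "elem_kernel j d = (\<Sum>i\<le>j. zeta_kernel i d * elem_harm (j - i) d)"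

text \<open>This is the recurrence that \<open>kernel_sum_plus1\<close> yields for the series
  itself. \<open>A\<close> at \<open>d\<close> and \<open>B\<close> at \<open>d + 1\<close> express
  both sides through the same zeta values and elementary functions at \<open>d\<close>, and then
  only the first harmonic number changes.\<close>

lemma elem_kernel_plus1:
  assumes "d > 0"
  shows "elem_kernel (Suc j) (d + 1) = elem_kernel (Suc j) d + elem_kernel j d / d + elem_harm (Suc j) d / (d + 1)"
proof -
  \<comment> \<open>Here \<open>z i\<close> is zeta(i + 1), with 0 in place of the divergent
    zeta(1), so that index shifts produce no extra term.\<close>
  define z where "z i = (if i = 0 then 0 else zeta_nat (i + 1))" for i
  have A: "elem_kernel (Suc j) x = shifted_harm 1 x * elem_harm (Suc j) x + (\<Sum>i\<le>j. z (Suc i) * elem_harm (j - i) x) - elem_kernel j x / x"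
    if "x > 0" for x j
  proof -
    have "elem_kernel (Suc j) x = shifted_harm 1 x * elem_harm (Suc j) x + (\<Sum>i\<le>j. zeta_kernel (Suc i) x * elem_harm (j - i) x)"
      unfolding elem_kernel_def by (subst sum.atMost_Suc_shift) (simp add: zeta_kernel_0)
    also have "(\<Sum>i\<le>j. zeta_kernel (Suc i) x * elem_harm (j - i) x) = (\<Sum>i\<le>j. z (Suc i) * elem_harm (j - i) x - zeta_kernel i x * elem_harm (j - i) x / x)"
      by (intro sum.cong refl) (simp add: zeta_kernel_Suc[OF that] z_def algebra_simps)
    finally show ?thesis by (simp add: elem_kernel_def sum_subtractf sum_divide_distrib)
  qed
  \<comment> \<open>At \<open>x + 1\<close> with elementary functions at \<open>x\<close> all
    kernels of positive index disappear: in \<open>A\<close> at \<open>x + 1\<close>, the shift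
    corrections cancel against the induction hypothesis divided by \<open>x + 1\<close>.\<close>
  have B: "elem_kernel j (x + 1) = shifted_harm 1 (x + 1) * elem_harm j x + (\<Sum>i\<le>j. z i * elem_harm (j - i) x)" if "x > 0" for x j
  proof (induction j)
    case 0
    show ?case by (simp add: elem_kernel_def zeta_kernel_0 elem_harm_def z_def)
  next
    case (Suc j)
    \<comment> \<open>Each elementary function is shifted down from \<open>x + 1\<close> to
      \<open>x\<close>, except that of index 0, which is constant.\<close>
    have step: "(\<Sum>i\<le>j. z (Suc i) * elem_harm (j - i) (x + 1)) 
       = (\<Sum>i\<le>j. z (Suc i) * elem_harm (j - i) x) + (\<Sum>i\<le>j. z i * elem_harm (j - i) x) / (x + 1)"
    proof (cases j)
      case 0
      thus ?thesis by (simp add: elem_harm_def z_def)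
    next
      case j: (Suc l)
      have "(\<Sum>i\<le>l. z (Suc i) * elem_harm (Suc l - i) (x + 1)) =
            (\<Sum>i\<le>l. z (Suc i) * elem_harm (Suc l - i) x + z (Suc i) * elem_harm (l - i) x / (x + 1))"
        using that by (intro sum.cong) (auto simp: Suc_diff_le elem_harm_plus1 distrib_left)
      also have "\<dots> = (\<Sum>i\<le>l. z (Suc i) * elem_harm (Suc l - i) x) + (\<Sum>i\<le>l. z (Suc i) * elem_harm (l - i) x) / (x + 1)"
        by (simp add: sum.distrib sum_divide_distrib)
      also have "(\<Sum>i\<le>l. z (Suc i) * elem_harm (l - i) x) = (\<Sum>i\<le>Suc l. z i * elem_harm (Suc l - i) x)"
        by (subst sum.atMost_Suc_shift) (simp add: z_def)
      finally show ?thesis unfolding j by (simp add: elem_harm_def)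
    qed
    have "(\<Sum>i\<le>Suc j. z i * elem_harm (Suc j - i) x) = (\<Sum>i\<le>j. z (Suc i) * elem_harm (j - i) x)"
      by (subst sum.atMost_Suc_shift) (simp add: z_def)
    thus ?case using A[of "x + 1" j] that Suc step elem_harm_plus1[of x j]
      by (simp add: algebra_simps add_divide_distrib)
  qed
  have "(\<Sum>i\<le>Suc j. z i * elem_harm (Suc j - i) d) = (\<Sum>i\<le>j. z (Suc i) * elem_harm (j - i) d)"
    by (subst sum.atMost_Suc_shift) (simp add: z_def)
  thus ?thesis using A[OF assms, of j] B[OF assms, of "Suc j"] shifted_harm_plus1[of d 1] assms
    by (simp add: algebra_simps)
qed

text \<open>As for complete functions, but the increment of \<open>elem_harm (Suc j)\<close> brings
  the denominator n + d + 1, so the lower series appears at \<open>d\<close> itself, divided by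
  \<open>d\<close>.\<close>

lemma kernel_sum_elem_harm:
  assumes "d > 0"
  shows "kernel_sum (elem_harm j) d = elem_kernel j d"
  using assms
proof (induction j arbitrary: d)
  case 0
  thus ?case by (simp add: kernel_sum_def elem_harm_def elem_kernel_def zeta_kernel_def)
next
  case (Suc j)
  let ?D = "\<lambda>d. kernel_sum (elem_harm (Suc j)) d - elem_kernel (Suc j) d"
  have "?D d = 0"
  proof (rule periodic_slow_linear_at_0_zero[of ?D])
    show "slow ?D" unfolding elem_kernel_def
      by (intro slow_diff slow_kernel_sum slow_tame tame_sum tame_mult tame_zeta_kernel tame_elem_harm)
    show "linear_at_0 ?D" unfolding elem_kernel_def
      by (intro linear_at_0_diff linear_at_0_kernel_sum linear_at_0_sum linear_at_0_mult_tame linear_at_0_zeta_kernel tame_elem_harm) auto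
    fix d :: real assume d: "d > 0"
    have "(\<lambda>n. (elem_harm (Suc j) (real n + d + 1) - elem_harm (Suc j) (real n + d)) / real (Suc n)) sums
       (kernel_sum (elem_harm (Suc j)) (d + 1) - kernel_sum (elem_harm (Suc j)) d - elem_harm (Suc j) d / (1 + d))"
      using d by (intro kernel_sum_plus1 tame_elem_harm) auto
    moreover have "(\<lambda>n. elem_harm j (real n + d) * (1 / real (Suc n) - 1 / (real (Suc n) + d)) / d)
        sums (kernel_sum (elem_harm j) d / d)"
      using d by (intro sums_divide kernel_sum_sums tame_elem_harm) auto
    moreover have "(elem_harm (Suc j) (real n + d + 1) - elem_harm (Suc j) (real n + d)) / real (Suc n)
       = elem_harm j (real n + d) * (1 / real (Suc n) - 1 / (real (Suc n) + d)) / d" for n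
    proof -
      have "1 / real (Suc n) - 1 / (real (Suc n) + d) = d / (real (Suc n) * (real n + d + 1))"
        using d by (simp add: field_simps)
      thus ?thesis using d elem_harm_plus1[of "real n + d" j] by (simp add: add_ac)
    qed
    ultimately have "kernel_sum (elem_harm (Suc j)) (d + 1) - kernel_sum (elem_harm (Suc j)) d - elem_harm (Suc j) d / (1 + d) = kernel_sum (elem_harm j) d / d"
      using sums_unique2 by simp
    also have "\<dots> = elem_kernel j d / d" using Suc.IH[of d] d by simp
    finally show "?D (d + 1) = ?D d"
      using elem_kernel_plus1[OF d, of j] by (simp add: add_ac)
  qed (use Suc in auto)
  thus ?case by simp
qed

section \<open>Expressions in zeta values and shifted harmonic numbers\<close>

lemma poly_map_of_rat_mult:
  "poly (map_poly of_rat (p * q)) (x :: real) = poly (map_poly of_rat p) x * poly (map_poly of_rat q) x"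
proof -
  have "map_poly of_rat (p * q) = map_poly of_rat p * (map_poly of_rat q :: real poly)"
    by (rule poly_eqI) (simp add: coeff_map_poly coeff_mult of_rat_sum of_rat_mult)
  thus ?thesis by simp
qed

fun zh_mult :: "zh_term \<Rightarrow> zh_term \<Rightarrow> zh_term" where
  "zh_mult (p, q, ss, hs) (p', q', ss', hs') = (p * p', q * q', ss @ ss', hs @ hs')"

lemma zh_mult_simps:
  "zh_term_val (zh_mult u v) a = zh_term_val u a * zh_term_val v a"
  "zh_term_shape u \<Longrightarrow> zh_term_shape v \<Longrightarrow> zh_term_shape (zh_mult u v)"
  "zh_term_defined u a \<Longrightarrow> zh_term_defined v a \<Longrightarrow> zh_term_defined (zh_mult u v) a"
  by (cases u; cases v;
      auto simp: zh_term_val_def zh_term_shape_def zh_term_defined_def rat_fun_def poly_map_of_rat_mult)+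

text \<open>The target form without the series. The term list is chosen before \<open>a\<close>, so
  one list serves all \<open>a > K\<close>; this uniformity survives sums and products.\<close>

definition zh_expr :: "nat \<Rightarrow> (real \<Rightarrow> real) \<Rightarrow> bool" where
  "zh_expr K g \<longleftrightarrow> (\<exists>ts. (\<forall>tm\<in>set ts. zh_term_shape tm) \<and> (\<forall>a > real K.
      (\<forall>tm\<in>set ts. zh_term_defined tm a) \<and> g a = (\<Sum>tm\<leftarrow>ts. zh_term_val tm a)))"

lemma zh_exprI:
  assumes "\<And>tm. tm \<in> set ts \<Longrightarrow> zh_term_shape tm"
    and "\<And>a tm. a > real K \<Longrightarrow> tm \<in> set ts \<Longrightarrow> zh_term_defined tm a"
    and "\<And>a. a > real K \<Longrightarrow> g a = (\<Sum>tm\<leftarrow>ts. zh_term_val tm a)"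
  shows "zh_expr K g"
  using assms unfolding zh_expr_def by blast

lemma zh_exprE:
  assumes "zh_expr K g"
  obtains ts where "\<And>tm. tm \<in> set ts \<Longrightarrow> zh_term_shape tm"
    and "\<And>a tm. a > real K \<Longrightarrow> tm \<in> set ts \<Longrightarrow> zh_term_defined tm a"
    and "\<And>a. a > real K \<Longrightarrow> g a = (\<Sum>tm\<leftarrow>ts. zh_term_val tm a)"
  using assms unfolding zh_expr_def by blast

lemma zh_expr_cong: "zh_expr K g \<Longrightarrow> (\<And>a. a > real K \<Longrightarrow> f a = g a) \<Longrightarrow> zh_expr K f"
  unfolding zh_expr_def by simp

lemma zh_expr_of_rat: "zh_expr K (\<lambda>_. of_rat c)"
  by (rule zh_exprI[of "[([:c:], 1, [], [])]"])
     (auto simp: zh_term_val_def zh_term_shape_def zh_term_defined_def rat_fun_def map_poly_pCons)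

lemma zh_expr_rat: "c \<in> \<rat> \<Longrightarrow> zh_expr K (\<lambda>_. c)"
  by (auto simp: Rats_def zh_expr_of_rat)

text \<open>From \<open>c \<ge> - real K\<close> and \<open>a > real K\<close> follows
  \<open>a + c > 0\<close>, so the denominator does not vanish. The same bound keeps harmonic
  arguments away from the negative integers.\<close>

lemma zh_expr_inverse:
  assumes "c \<in> \<int>" "c \<ge> - real K" shows "zh_expr K (\<lambda>a. 1 / (a + c))"
proof -
  from assms(1) obtain t where t: "c = of_int t" by (auto elim: Ints_cases)
  show ?thesis
    by (rule zh_exprI[of "[(1, [:of_int t, 1:], [], [])]"])
       (use assms in \<open>auto simp: zh_term_val_def zh_term_shape_def zh_term_defined_def rat_fun_def
         map_poly_pCons t add.commute\<close>)
qed

lemma zh_expr_zeta: "s \<ge> 2 \<Longrightarrow> zh_expr K (\<lambda>_. zeta_nat s)"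
  by (rule zh_exprI[of "[(1, 1, [s], [])]"])
     (auto simp: zh_term_val_def zh_term_shape_def zh_term_defined_def rat_fun_def)

lemma zh_expr_shifted_harm:
  assumes "m > 0" "c \<in> \<int>" "c \<ge> - real K" shows "zh_expr K (\<lambda>a. shifted_harm m (a + c))"
proof -
  from assms(2) obtain t where t: "c = of_int t" by (auto elim: Ints_cases)
  show ?thesis
    by (rule zh_exprI[of "[(1, 1, [], [(m, t)])]"])
       (use assms in \<open>auto simp: zh_term_val_def zh_term_shape_def zh_term_defined_def rat_fun_def t\<close>)
qed

lemma zh_expr_add:
  assumes "zh_expr K f" "zh_expr K g" shows "zh_expr K (\<lambda>a. f a + g a)"
proof -
  from assms(1) obtain ts where ts: "\<And>tm. tm \<in> set ts \<Longrightarrow> zh_term_shape tm"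
    "\<And>a tm. a > real K \<Longrightarrow> tm \<in> set ts \<Longrightarrow> zh_term_defined tm a"
    "\<And>a. a > real K \<Longrightarrow> f a = (\<Sum>tm\<leftarrow>ts. zh_term_val tm a)" by (rule zh_exprE) blast
  from assms(2) obtain us where us: "\<And>tm. tm \<in> set us \<Longrightarrow> zh_term_shape tm"
    "\<And>a tm. a > real K \<Longrightarrow> tm \<in> set us \<Longrightarrow> zh_term_defined tm a"
    "\<And>a. a > real K \<Longrightarrow> g a = (\<Sum>tm\<leftarrow>us. zh_term_val tm a)" by (rule zh_exprE) blast
  show ?thesis by (rule zh_exprI[of "ts @ us"]) (use ts us in auto)
qed

lemma zh_expr_times:
  assumes "zh_expr K f" "zh_expr K g" shows "zh_expr K (\<lambda>a. f a * g a)"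
proof -
  from assms(1) obtain ts where ts: "\<And>tm. tm \<in> set ts \<Longrightarrow> zh_term_shape tm"
    "\<And>a tm. a > real K \<Longrightarrow> tm \<in> set ts \<Longrightarrow> zh_term_defined tm a"
    "\<And>a. a > real K \<Longrightarrow> f a = (\<Sum>tm\<leftarrow>ts. zh_term_val tm a)" by (rule zh_exprE) blast
  from assms(2) obtain us where us: "\<And>tm. tm \<in> set us \<Longrightarrow> zh_term_shape tm"
    "\<And>a tm. a > real K \<Longrightarrow> tm \<in> set us \<Longrightarrow> zh_term_defined tm a"
    "\<And>a. a > real K \<Longrightarrow> g a = (\<Sum>tm\<leftarrow>us. zh_term_val tm a)" by (rule zh_exprE) blast
  let ?ps = "concat (map (\<lambda>u. map (zh_mult u) us) ts)"
  have val: "(\<Sum>tm\<leftarrow>?ps. zh_term_val tm a) =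
      (\<Sum>tm\<leftarrow>ts. zh_term_val tm a) * (\<Sum>tm\<leftarrow>us. zh_term_val tm a)" for a
    by (induction ts) (auto simp: zh_mult_simps(1) o_def sum_list_const_mult distrib_right)
  show ?thesis
  proof (rule zh_exprI[of ?ps])
    fix tm assume "tm \<in> set ?ps"
    then obtain u v where uv: "u \<in> set ts" "v \<in> set us" "tm = zh_mult u v" by force
    show "zh_term_shape tm" unfolding uv(3) by (intro zh_mult_simps ts us uv)
    show "zh_term_defined tm a" if "a > real K" for a
      unfolding uv(3) by (intro zh_mult_simps ts us uv that)
  next
    fix a :: real assume "a > real K"
    thus "f a * g a = (\<Sum>tm\<leftarrow>?ps. zh_term_val tm a)" using ts(3) us(3) val by simp
  qed
qed

lemma zh_expr_cmult: "zh_expr K f \<Longrightarrow> c \<in> \<rat> \<Longrightarrow> zh_expr K (\<lambda>a. c * f a)"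
  by (rule zh_expr_times[OF zh_expr_rat])

lemma zh_expr_diff: "zh_expr K f \<Longrightarrow> zh_expr K g \<Longrightarrow> zh_expr K (\<lambda>a. f a - g a)"
  using zh_expr_add[OF _ zh_expr_cmult[of K g "-1"], of f] by simp

lemma zh_expr_sum: "(\<And>i. i \<in> A \<Longrightarrow> zh_expr K (f i)) \<Longrightarrow> zh_expr K (\<lambda>a. \<Sum>i\<in>A. f i a)"
  by (induction A rule: infinite_finite_induct) (auto intro: zh_expr_rat zh_expr_add)

text \<open>Newton's recursion makes \<open>hsym\<close> a polynomial with rational coefficients in
  the power sums.\<close>

lemma zh_expr_hsym:
  assumes "\<And>i. i > 0 \<Longrightarrow> zh_expr K (\<lambda>a. p a i)"
  shows "zh_expr K (\<lambda>a. hsym (p a) j)"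
proof (induction j rule: less_induct)
  case (less j)
  show ?case
  proof (cases j)
    case (Suc l)
    have "zh_expr K (\<lambda>a. \<Sum>i\<le>l. p a (Suc i) * hsym (p a) (l - i))"
      by (intro zh_expr_sum zh_expr_times assms less.IH) (auto simp: Suc)
    from zh_expr_cmult[OF this, of "1 / real (Suc l)"] show ?thesis
      by (simp add: Suc hsym.simps(2))
  qed (auto intro: zh_expr_rat)
qed

lemma zh_expr_complete_harm: "c \<in> \<int> \<Longrightarrow> c \<ge> - real K \<Longrightarrow> zh_expr K (\<lambda>a. complete_harm j (a + c))"
  unfolding complete_harm_def by (intro zh_expr_hsym zh_expr_shifted_harm)

lemma zh_expr_elem_harm: "c \<in> \<int> \<Longrightarrow> c \<ge> - real K \<Longrightarrow> zh_expr K (\<lambda>a. elem_harm j (a + c))"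
  unfolding elem_harm_def by (intro zh_expr_hsym zh_expr_cmult zh_expr_shifted_harm) auto

lemma zh_expr_zeta_kernel:
  assumes c: "c \<in> \<int>" "c \<ge> - real K" shows "zh_expr K (\<lambda>a. zeta_kernel i (a + c))"
proof (induction i)
  case 0
  show ?case using zh_expr_shifted_harm[OF _ c, of 1] by (simp add: zeta_kernel_0)
next
  case (Suc i)
  have "zh_expr K (\<lambda>a. zeta_nat (i + 2) - zeta_kernel i (a + c) * (1 / (a + c)))"
    by (intro zh_expr_diff zh_expr_zeta zh_expr_times zh_expr_inverse c Suc) simp
  thus ?case by (rule zh_expr_cong) (use c in \<open>auto simp: zeta_kernel_Suc\<close>)
qed

lemma zh_expr_elem_kernel: "c \<in> \<int> \<Longrightarrow> c \<ge> - real K \<Longrightarrow> zh_expr K (\<lambda>a. elem_kernel j (a + c))"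
  unfolding elem_kernel_def by (intro zh_expr_sum zh_expr_times zh_expr_zeta_kernel zh_expr_elem_harm)

section \<open>Series whose sums are such expressions\<close>

definition zh_series :: "nat \<Rightarrow> (real \<Rightarrow> nat \<Rightarrow> real) \<Rightarrow> bool" where
  "zh_series K f \<longleftrightarrow> (\<exists>g. zh_expr K g \<and> (\<forall>a > real K. f a sums g a))"

lemma zh_seriesI: "zh_expr K g \<Longrightarrow> (\<And>a. a > real K \<Longrightarrow> f a sums g a) \<Longrightarrow> zh_series K f"
  unfolding zh_series_def by blast

lemma zh_series_cong: "zh_series K g \<Longrightarrow> (\<And>a n. a > real K \<Longrightarrow> f a n = g a n) \<Longrightarrow> zh_series K f"
  unfolding zh_series_def by (metis ext)

lemma zh_series_add:
  assumes "zh_series K f" "zh_series K g" shows "zh_series K (\<lambda>a n. f a n + g a n)"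
proof -
  from assms obtain F G where "zh_expr K F" "zh_expr K G" "\<And>a. a > real K \<Longrightarrow> f a sums F a" "\<And>a. a > real K \<Longrightarrow> g a sums G a"
    unfolding zh_series_def by blast
  thus ?thesis by (intro zh_seriesI[of K "\<lambda>a. F a + G a"] zh_expr_add sums_add) auto
qed

lemma zh_series_times:
  assumes "zh_expr K c" "zh_series K f" shows "zh_series K (\<lambda>a n. c a * f a n)"
proof -
  from assms obtain F where "zh_expr K F" "\<And>a. a > real K \<Longrightarrow> f a sums F a"
    unfolding zh_series_def by blast
  thus ?thesis using assms by (intro zh_seriesI[of K "\<lambda>a. c a * F a"] zh_expr_times sums_mult) auto
qed

lemma zh_series_cmult: "c \<in> \<rat> \<Longrightarrow> zh_series K f \<Longrightarrow> zh_series K (\<lambda>a n. c * f a n)"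
  by (rule zh_series_times[OF zh_expr_rat])

lemma zh_series_diff: "zh_series K f \<Longrightarrow> zh_series K g \<Longrightarrow> zh_series K (\<lambda>a n. f a n - g a n)"
  using zh_series_add[OF _ zh_series_cmult[of "-1" K g], of f] by simp

lemma has_zeta_harm_formI:
  assumes "zh_series (max k r) (\<lambda>a n. f a (Suc n))" shows "has_zeta_harm_form k r f"
proof -
  from assms obtain g where "zh_expr (max k r) g" and g: "\<And>a. a > real (max k r) \<Longrightarrow> (\<lambda>n. f a (Suc n)) sums g a"
    unfolding zh_series_def by blast
  from this(1) show ?thesis unfolding has_zeta_harm_form_def zh_expr_def using g by metis
qed

text \<open>Put d = a + c - r, which is positive because a > K \<ge> r and c \<ge> 0. Dropping the
  first \<open>r\<close> terms of the kernel series at d shifts its denominators to those wanted;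
  this uses that \<open>r\<close> is an integer. The dropped terms are finitely many
  expressions.\<close>

lemma zh_series_kernel_sum:
  assumes f: "tame f" and r: "r \<le> K" and c: "c \<in> \<int>" "c \<ge> 0"
    and zf: "\<And>c. c \<in> \<int> \<Longrightarrow> c \<ge> - real K \<Longrightarrow> zh_expr K (\<lambda>a. f (a + c))"
    and zs: "\<And>c. c \<in> \<int> \<Longrightarrow> c \<ge> - real K \<Longrightarrow> zh_expr K (\<lambda>a. kernel_sum f (a + c))"
  shows "zh_series K (\<lambda>a n. f (real n + a + c) * (1 / (real (Suc n) + real r) - 1 / (real (Suc n) + (a + c))))"
proof (rule zh_seriesI)
  let ?t = "\<lambda>d n. f (real n + d) * (1 / real (Suc n) - 1 / (real (Suc n) + d))"
  show "zh_expr K (\<lambda>a. kernel_sum f (a + (c - real r)) - (\<Sum>i<r. ?t (a + (c - real r)) i))"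
  proof (intro zh_expr_diff zs zh_expr_sum zh_expr_times)
    fix i assume i: "i \<in> {..<r}"
    show "zh_expr K (\<lambda>a. f (real i + (a + (c - real r))))"
      by (rule zh_expr_cong[OF zf[of "real i + c - real r"]]) (use c r in \<open>auto simp: algebra_simps\<close>)
    have "zh_expr K (\<lambda>a. 1 / (a + (real (Suc i) + c - real r)))"
      by (rule zh_expr_inverse) (use c r in auto)
    thus "zh_expr K (\<lambda>a. 1 / (real (Suc i) + (a + (c - real r))))"
      by (rule zh_expr_cong) (simp add: algebra_simps)
  qed (use c r in \<open>auto intro: zh_expr_rat\<close>)
  fix a assume a: "a > real K"
  have "?t (a + (c - real r)) sums kernel_sum f (a + (c - real r))"
    using a c r by (intro kernel_sum_sums f) auto
  from sums_split_initial_segment[OF this, of r]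
  have "(\<lambda>n. ?t (a + (c - real r)) (n + r)) sums
      (kernel_sum f (a + (c - real r)) - (\<Sum>i<r. ?t (a + (c - real r)) i))" .
  moreover have "real (n + r) + (a + (c - real r)) = real n + a + c"
    "real (Suc (n + r)) + (a + (c - real r)) = real (Suc n) + (a + c)"
    "real (Suc (n + r)) = real (Suc n) + real r" for n by simp_all
  ultimately show "(\<lambda>n. f (real n + a + c) * (1 / (real (Suc n) + real r) - 1 / (real (Suc n) + (a + c)))) sums
      (kernel_sum f (a + (c - real r)) - (\<Sum>i<r. ?t (a + (c - real r)) i))"
    by (simp only:)
qed

text \<open>The shift by 1 built into \<open>f\<close> already turns n + a into the argument
  \<open>real (Suc n) + a\<close>, so \<open>c = 0\<close>.\<close>

lemma zh_series_complete_harm_kernel: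
  assumes "r \<le> K"
  shows "zh_series K (\<lambda>a n. complete_harm j (real (Suc n) + a) * (1 / (real (Suc n) + real r) - 1 / (real (Suc n) + a)))"
proof -
  have "zh_series K (\<lambda>a n. complete_harm j (real n + a + 0 + 1) * (1 / (real (Suc n) + real r) - 1 / (real (Suc n) + (a + 0))))"
  proof (rule zh_series_kernel_sum[where f = "\<lambda>x. complete_harm j (x + 1)" and c = 0])
    fix c assume c: "c \<in> \<int>" "c \<ge> - real K"
    have "zh_expr K (\<lambda>a. complete_harm j (a + (c + 1)))" using c by (intro zh_expr_complete_harm) auto
    thus "zh_expr K (\<lambda>a. complete_harm j (a + c + 1))" by (simp add: add_ac)
    have "zh_expr K (\<lambda>a. real (Suc j) * complete_harm (Suc j) (a + c))" using c by (intro zh_expr_cmult zh_expr_complete_harm) auto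
    thus "zh_expr K (\<lambda>a. kernel_sum (\<lambda>x. complete_harm j (x + 1)) (a + c))"
      by (rule zh_expr_cong) (use c in \<open>auto simp: kernel_sum_complete_harm\<close>)
  qed (use assms in \<open>auto intro: tame_plus1 tame_complete_harm\<close>)
  thus ?thesis by (simp add: add_ac)
qed

text \<open>Here \<open>f\<close> carries no shift, so \<open>c = 1\<close> supplies it, and the
  second denominator moves to \<open>real (Suc n) + (a + 1)\<close>.\<close>

lemma zh_series_elem_harm_kernel:
  assumes "r \<le> K"
  shows "zh_series K (\<lambda>a n. elem_harm j (real (Suc n) + a) * (1 / (real (Suc n) + real r) - 1 / (real (Suc n) + (a + 1))))"
proof -
  have "zh_series K (\<lambda>a n. elem_harm j (real n + a + 1) * (1 / (real (Suc n) + real r) - 1 / (real (Suc n) + (a + 1))))"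
  proof (rule zh_series_kernel_sum[where f = "elem_harm j" and c = 1])
    fix c assume c: "c \<in> \<int>" "c \<ge> - real K"
    show "zh_expr K (\<lambda>a. kernel_sum (elem_harm j) (a + c))"
      by (rule zh_expr_cong[OF zh_expr_elem_kernel[OF c, of j]]) (use c in \<open>auto simp: kernel_sum_elem_harm\<close>)
  qed (use assms in \<open>auto intro: tame_elem_harm zh_expr_elem_harm\<close>)
  thus ?thesis by (simp add: add_ac)
qed

section \<open>Reduction of the product denominator\<close>

lemma inverse_product_split:
  assumes "k \<noteq> r"
  shows "1 / ((real (Suc n) + real r) * (real (Suc n) + real k)) =
     1 / (real k - real r) * (1 / (real (Suc n) + real r) - 1 / (real (Suc n) + real k))"
  using assms by (simp add: divide_simps)

lemma zh_series_div_product: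
  assumes "k \<noteq> r"
    and "zh_series K (\<lambda>a n. f a n * (1 / (real (Suc n) + real r) - 1 / (real (Suc n) + real k)))"
  shows "zh_series K (\<lambda>a n. f a n / ((real (Suc n) + real r) * (real (Suc n) + real k)))"
proof -
  have "zh_series K (\<lambda>a n. 1 / (real k - real r) * (f a n * (1 / (real (Suc n) + real r) - 1 / (real (Suc n) + real k))))"
    using assms(2) by (intro zh_series_cmult) auto
  moreover have "f a n / ((real (Suc n) + real r) * (real (Suc n) + real k)) =
     1 / (real k - real r) * (f a n * (1 / (real (Suc n) + real r) - 1 / (real (Suc n) + real k)))" for a n
    using inverse_product_split[OF assms(1), of n] by (metis mult.left_commute times_divide_eq_right mult.right_neutral)
  ultimately show ?thesis by simp
qed

text \<open>In the difference of the kernels for \<open>r\<close> and \<open>k\<close> the fraction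
  depending on \<open>a\<close> cancels.\<close>

lemma zh_series_complete_harm:
  assumes "k \<noteq> r" "r \<le> K" "k \<le> K"
  shows "zh_series K (\<lambda>a n. complete_harm j (real (Suc n) + a) / ((real (Suc n) + real r) * (real (Suc n) + real k)))"
  by (intro zh_series_div_product assms
      zh_series_cong[OF zh_series_diff[OF zh_series_complete_harm_kernel[OF assms(2), of j] zh_series_complete_harm_kernel[OF assms(3), of j]]])
     (simp add: algebra_simps)

lemma zh_series_elem_harm:
  assumes "k \<noteq> r" "r \<le> K" "k \<le> K"
  shows "zh_series K (\<lambda>a n. elem_harm j (real (Suc n) + a) / ((real (Suc n) + real r) * (real (Suc n) + real k)))"
  by (intro zh_series_div_product assms
      zh_series_cong[OF zh_series_diff[OF zh_series_elem_harm_kernel[OF assms(2), of j] zh_series_elem_harm_kernel[OF assms(3), of j]]])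
     (simp add: algebra_simps)

section \<open>The series of a single power sum\<close>

lemma shifted_harm_of_nat_Rats: "m > 0 \<Longrightarrow> shifted_harm m (real N) \<in> \<rat>"
proof (induction N)
  case (Suc N)
  thus ?case using shifted_harm_plus1[of "real N" m] by (simp add: add.commute)
qed (simp add: shifted_harm_0)

text \<open>With x, y the two linear factors, x - y = a - r does not depend on \<open>n\<close>, and
  1/(x^(m+2) y) = (1/(x^(m+1) y) - 1/x^(m+2))/(x - y) lowers the exponent. The base case is a
  difference of two harmonic series.\<close>

lemma zh_series_partial_fraction:
  assumes "r < K"
  shows "zh_series K (\<lambda>a n. 1 / ((real (Suc n) + (a + 1)) ^ Suc m * (real (Suc n) + (real r + 1))))"
proof (induction m)
  case 0
  have "zh_series K (\<lambda>a n. (1 / real (Suc n) ^ 1 - 1 / (real (Suc n) + (a + 1)) ^ 1)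
      - (1 / real (Suc n) ^ 1 - 1 / (real (Suc n) + (real r + 1)) ^ 1))"
  proof (rule zh_seriesI)
    show "zh_expr K (\<lambda>a. shifted_harm 1 (a + 1) - shifted_harm 1 (real (Suc r)))"
      by (intro zh_expr_diff zh_expr_shifted_harm zh_expr_rat shifted_harm_of_nat_Rats) auto
    fix a assume "a > real K"
    thus "(\<lambda>n. (1 / real (Suc n) ^ 1 - 1 / (real (Suc n) + (a + 1)) ^ 1)
      - (1 / real (Suc n) ^ 1 - 1 / (real (Suc n) + (real r + 1)) ^ 1))
      sums (shifted_harm 1 (a + 1) - shifted_harm 1 (real (Suc r)))"
      using sums_diff[OF shifted_harm_sums[of "a + 1" 1] shifted_harm_sums[of "real r + 1" 1]]
      by (simp only: of_nat_Suc add.commute[of 1])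
  qed
  from zh_series_times[OF zh_expr_inverse this, of "- real r"] assms
  have "zh_series K (\<lambda>a n. 1 / (a + - real r) * ((1 / real (Suc n) ^ 1 - 1 / (real (Suc n) + (a + 1)) ^ 1)
      - (1 / real (Suc n) ^ 1 - 1 / (real (Suc n) + (real r + 1)) ^ 1)))" by auto
  thus ?case
  proof (rule zh_series_cong)
    fix a n assume "a > real K"
    hence "a + - real r > 0" "real (Suc n) + (a + 1) > 0" "real (Suc n) + (real r + 1) > 0" using assms by linarith+
    thus "1 / ((real (Suc n) + (a + 1)) ^ Suc 0 * (real (Suc n) + (real r + 1))) =
       1 / (a + - real r) * ((1 / real (Suc n) ^ 1 - 1 / (real (Suc n) + (a + 1)) ^ 1)
      - (1 / real (Suc n) ^ 1 - 1 / (real (Suc n) + (real r + 1)) ^ 1))"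
      by (simp add: divide_simps) (simp add: algebra_simps)
  qed
next
  case (Suc m)
  \<comment> \<open>This is the Hurwitz zeta value at (m + 2, a + 2), that is, a zeta value minus a
    shifted harmonic number.\<close>
  have "zh_series K (\<lambda>a n. 1 / (real (Suc n) + (a + 1)) ^ Suc (Suc m))"
  proof (rule zh_seriesI)
    show "zh_expr K (\<lambda>a. zeta_nat (Suc (Suc m)) - shifted_harm (Suc (Suc m)) (a + 1))"
      by (intro zh_expr_diff zh_expr_zeta zh_expr_shifted_harm) auto
    fix a assume "a > real K"
    hence "(\<lambda>n. 1 / real (Suc n) ^ Suc (Suc m) - (1 / real (Suc n) ^ Suc (Suc m) - 1 / (real (Suc n) + (a + 1)) ^ Suc (Suc m)))
        sums (zeta_nat (Suc (Suc m)) - shifted_harm (Suc (Suc m)) (a + 1))"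
      unfolding zeta_nat_def
      by (intro sums_diff shifted_harm_sums summable_sums summable_inverse_Suc_power) auto
    thus "(\<lambda>n. 1 / (real (Suc n) + (a + 1)) ^ Suc (Suc m))
        sums (zeta_nat (Suc (Suc m)) - shifted_harm (Suc (Suc m)) (a + 1))" by simp
  qed
  from zh_series_times[OF zh_expr_inverse zh_series_diff[OF Suc this], of "- real r"] assms
  have "zh_series K (\<lambda>a n. 1 / (a + - real r) * (1 / ((real (Suc n) + (a + 1)) ^ Suc m * (real (Suc n) + (real r + 1)))
      - 1 / (real (Suc n) + (a + 1)) ^ Suc (Suc m)))" by auto
  thus ?case
  proof (rule zh_series_cong)
    fix a n assume "a > real K"
    hence *: "a + - real r > 0" "real (Suc n) + (a + 1) > 0" "real (Suc n) + (real r + 1) > 0" using assms by linarith+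
    define x y where "x = real (Suc n) + (a + 1)" and "y = real (Suc n) + (real r + 1)"
    have d: "a + - real r = x - y" by (simp add: x_def y_def)
    have "x > 0" "y > 0" "x - y > 0" using * by (simp_all add: x_def y_def)
    hence "1 / (x ^ Suc (Suc m) * y) = 1 / (x - y) * (1 / (x ^ Suc m * y) - 1 / x ^ Suc (Suc m))"
      by (simp add: divide_simps)
    thus "1 / ((real (Suc n) + (a + 1)) ^ Suc (Suc m) * (real (Suc n) + (real r + 1))) =
       1 / (a + - real r) * (1 / ((real (Suc n) + (a + 1)) ^ Suc m * (real (Suc n) + (real r + 1)))
      - 1 / (real (Suc n) + (a + 1)) ^ Suc (Suc m))"
      unfolding d unfolding x_def[symmetric] y_def[symmetric] .
  qed
qed

text \<open>Summation by parts: for neighbouring denominators the summand is a telescoping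
  difference of \<open>g\<close> plus the increment of the harmonic number over a linear factor,
  which \<open>zh_series_partial_fraction\<close> sums.\<close>

lemma zh_series_shifted_harm_adjacent:
  assumes "m > 0" "r < K"
  shows "zh_series K (\<lambda>a n. shifted_harm m (real (Suc n) + a) *
     (1 / (real (Suc n) + real r) - 1 / (real (Suc n) + real (Suc r))))"
proof -
  define g where "g a n = shifted_harm m (real n + (a + 1)) / (real n + (real r + 1))" for a n
  have "zh_series K (\<lambda>a n. g a n - g a (Suc n))"
  proof (rule zh_seriesI)
    show "zh_expr K (\<lambda>a. shifted_harm m (a + 1) * (1 / (real r + 1)))"
      using assms by (intro zh_expr_times zh_expr_shifted_harm zh_expr_rat) auto
    fix a assume "a > real K"
    hence "g a \<longlonglongrightarrow> 0"
      unfolding g_def using assms by (intro tame_div_tendsto_0 tame_shifted_harm) auto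
    from telescope_sums'[OF this] show "(\<lambda>n. g a n - g a (Suc n)) sums (shifted_harm m (a + 1) * (1 / (real r + 1)))"
      by (simp add: g_def)
  qed
  from zh_series_add[OF this zh_series_partial_fraction[OF assms(2), of "m - 1"]] assms(1)
  have "zh_series K (\<lambda>a n. g a n - g a (Suc n) + 1 / ((real (Suc n) + (a + 1)) ^ m * (real (Suc n) + (real r + 1))))"
    by simp
  thus ?thesis
  proof (rule zh_series_cong)
    fix a n assume "a > real K"
    hence "shifted_harm m (real (Suc n) + (a + 1)) = shifted_harm m (real (Suc n) + a) + 1 / (real (Suc n) + (a + 1)) ^ m"
      using shifted_harm_plus1[of "real (Suc n) + a" m] assms by (simp add: add_ac)
    hence "g a (Suc n) = shifted_harm m (real (Suc n) + a) * (1 / (real (Suc n) + real (Suc r)))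
        + 1 / ((real (Suc n) + (a + 1)) ^ m * (real (Suc n) + (real r + 1)))"
      by (simp add: g_def add_divide_distrib add_ac)
    moreover have "g a n = shifted_harm m (real (Suc n) + a) * (1 / (real (Suc n) + real r))"
      by (simp add: g_def add_ac)
    ultimately show "shifted_harm m (real (Suc n) + a) * (1 / (real (Suc n) + real r) - 1 / (real (Suc n) + real (Suc r)))
       = g a n - g a (Suc n) + 1 / ((real (Suc n) + (a + 1)) ^ m * (real (Suc n) + (real r + 1)))"
      by (simp only: right_diff_distrib)
  qed
qed

text \<open>The kernel for \<open>r < k\<close> is the sum of the adjacent kernels between them; the
  denominator is symmetric, which covers \<open>k < r\<close>.\<close>

lemma zh_series_shifted_harm:
  assumes "m > 0" "k \<noteq> r" "r \<le> K" "k \<le> K"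
  shows "zh_series K (\<lambda>a n. shifted_harm m (real (Suc n) + a) / ((real (Suc n) + real r) * (real (Suc n) + real k)))"
proof -
  have le: "zh_series K (\<lambda>a n. shifted_harm m (real (Suc n) + a) * (1 / (real (Suc n) + real r) - 1 / (real (Suc n) + real k)))"
    if "r \<le> k" "k \<le> K" for r k
    using that
  proof (induction k rule: dec_induct)
    case base
    show ?case by (rule zh_seriesI[OF zh_expr_rat[of 0]]) auto
  next
    case (step k)
    have "zh_series K (\<lambda>a n. shifted_harm m (real (Suc n) + a) * (1 / (real (Suc n) + real r) - 1 / (real (Suc n) + real k)))"
      "zh_series K (\<lambda>a n. shifted_harm m (real (Suc n) + a) * (1 / (real (Suc n) + real k) - 1 / (real (Suc n) + real (Suc k))))"
      using step by (auto intro!: zh_series_shifted_harm_adjacent assms simp del: of_nat_Suc)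
    from zh_series_add[OF this] show ?case
      by (rule zh_series_cong) (simp only: distrib_left[symmetric], simp)
  qed
  show ?thesis
  proof (cases "r \<le> k")
    case True
    thus ?thesis using assms by (intro zh_series_div_product le) auto
  next
    case False
    hence "zh_series K (\<lambda>a n. shifted_harm m (real (Suc n) + a) / ((real (Suc n) + real k) * (real (Suc n) + real r)))"
      using assms by (intro zh_series_div_product le) auto
    thus ?thesis by (simp add: mult.commute)
  qed
qed

theorem theorem2p9:
  fixes k r m :: nat
  assumes "k > 0" and "r > 0" and "m > 0" and "k \<noteq> r"
  shows "has_zeta_harm_form k r
           (\<lambda>a n. shifted_harm m (real n + a) / ((real n + real r) * (real n + real k)))
       \<and> has_zeta_harm_form k r
           (\<lambda>a n. shifted_harm 1 (real n + a) * shifted_harm 2 (real n + a)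
                    / ((real n + real r) * (real n + real k)))
       \<and> has_zeta_harm_form k r
           (\<lambda>a n. (shifted_harm 1 (real n + a)) ^ 3 / ((real n + real r) * (real n + real k)))
       \<and> has_zeta_harm_form k r
           (\<lambda>a n. (shifted_harm 1 (real n + a)) ^ 2 * shifted_harm 2 (real n + a)
                    / ((real n + real r) * (real n + real k)))"
proof -
  let ?K = "max k r"
  let ?w = "\<lambda>n. (real (Suc n) + real r) * (real (Suc n) + real k)"
  have h: "zh_series ?K (\<lambda>a n. complete_harm j (real (Suc n) + a) / ?w n)"
    and e: "zh_series ?K (\<lambda>a n. elem_harm j (real (Suc n) + a) / ?w n)" for j
    using assms by (intro zh_series_complete_harm zh_series_elem_harm; simp)+
  have p: "zh_series ?K (\<lambda>a n. shifted_harm i (real (Suc n) + a) / ?w n)" if "i > 0" for i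
    using assms that by (intro zh_series_shifted_harm) auto
  show ?thesis
  proof (intro conjI has_zeta_harm_formI)
    show "zh_series ?K (\<lambda>a n. shifted_harm m (real (Suc n) + a) / ?w n)" using p assms by simp
    show "zh_series ?K (\<lambda>a n. shifted_harm 1 (real (Suc n) + a) * shifted_harm 2 (real (Suc n) + a) / ?w n)"
      by (rule zh_series_cong[OF zh_series_diff[OF h[of 3] e[of 3]]])
         (simp only: newton_products diff_divide_distrib)
    show "zh_series ?K (\<lambda>a n. shifted_harm 1 (real (Suc n) + a) ^ 3 / ?w n)"
      by (rule zh_series_cong[OF zh_series_diff[OF zh_series_add[OF zh_series_cmult[OF _ h[of 3], of 3]
             zh_series_cmult[OF _ e[of 3], of 3]] zh_series_cmult[OF _ p[of 3], of 2]]])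
         (simp_all only: newton_products diff_divide_distrib add_divide_distrib times_divide_eq_right, simp_all)
    show "zh_series ?K (\<lambda>a n. shifted_harm 1 (real (Suc n) + a) ^ 2 * shifted_harm 2 (real (Suc n) + a) / ?w n)"
      by (rule zh_series_cong[OF zh_series_diff[OF zh_series_diff[OF zh_series_cmult[OF _ h[of 4], of 2]
             zh_series_cmult[OF _ e[of 4], of 2]] p[of 4]]])
         (simp_all only: newton_products diff_divide_distrib times_divide_eq_right, simp_all)
  qed
qed

end
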